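(* Let $G$ be a finite graph satisfying the standing assumptions of the context, and suppose that the edge polytope $\mathcal{P}_G$ is simple and that $I_G\neq(0)$. Let the vertices of $G$ be labelled by $1,\dots,d$ according to the labelling convention in the context, and let $<_{\rm lex}$ be a lexicographic order on $\mathcal{R}_G$ as described in the context. Then the reduced Gröbner basis of the toric ideal $I_G$ with respect to $<_{\rm lex}$ consists of quadratic binomials with squarefree initial monomials.
   Context: Standing assumptions: $G$ is a finite graph on the vertex set $V(G)=\{1,\dots,d\}$, allowing loops, having no multiple edge and no isolated vertex (a vertex carrying a loop is not isolated); $E(G)$ is its set of edges and loops, a loop at $i$ being written $\{i,i\}$. Moreover $G$ satisfies condition $( * )$: if $G$ has a loop at each of $i$ and $j$, then $\{i,j\}\in E(G)$. Edge polytope: for $e=\{i,j\}\in E(G)$ put $\rho(e)=\mathbf{e}_i+\mathbf{e}_j\in\mathbb{R}^d$ (so $\rho(\{i,i\})=2\mathbf{e}_i$); $\mathcal{P}_G$ is the convex hull of $\{\rho(e): e\in E(G)\}$. A convex polytope of dimension $\delta$ is simple if each vertex belongs to exactly $\delta$ edges of the polytope. Toric ideal: let $K$ be a field, $\mathcal{R}_G=K[\{x_{ij}\}_{\{i,j\}\in E(G)}]$ the polynomial ring with one variable per edge or loop (with $x_{ij}=x_{ji}$), and $\pi:\mathcal{R}_G\to K[t_1,\dots,t_d]$ the $K$-algebra homomorphism with $\pi(x_{ij})=t_it_j$. The toric ideal $I_G$ is the kernel of $\pi$. Labelling convention. Let $W$ be the set of vertices of $G$ at which $G$ has no loop and $G'$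 the induced subgraph of $G$ on $W$. If $\mathcal{P}_G$ is simple and $I_G\ne(0)$, then $G$ is of one of the following types, and the vertices are labelled accordingly: ($\alpha$) $G$ is a complete bipartite graph with at least one cycle of length $4$; then the two parts are $V_1=\{1,\dots,m\}$ and $V_2=\{m+1,\dots,d\}$. ($\beta$) $G$ has exactly one loop, $G'$ is a complete bipartite graph (with nonempty parts), and the vertex with the loop is joined to all vertices of $W$; then the loop is at $1$ and the parts of $G'$ are $V_1=\{2,\dots,m\}$ and $V_2=\{m+1,\dots,d\}$. ($\gamma$) $G$ has at least two loops, $W\neq\emptyset$, $G'$ has no edge, and every vertex with a loop is joined to all vertices of $W$; then the vertices with loops are $1,\dots,m$ and $W=\{m+1,\dots,d\}$. (simplex) $\mathcal{P}_G$ is a simplex (and $G$ has at least two loops); then the vertices with loops are $1,\dots,m$. Monomial order: $<_{\rm lex}$ is a lexicographic order on $\mathcal{R}_G$ induced by an ordering of the variables satisfying: $x_{k\ell}<_{\rm lex}x_{ii}$ whenever $k<\ell$; and for $i<j$ and $k<\ell$, $x_{ij}<_{\rm lex}x_{k\ell}$ if and only if either (1) $i<k$, or (2) $i=k$ and $j>\ell$. *)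

theory Defs
  imports "HOL-Analysis.Analysis" "HOL-Library.Poly_Mapping" "HOL-Library.Uprod"
begin

section \<open>Graphs with loops\<close>

text \<open>
  A graph without multiple edges on the finite vertex set \<^term>\<open>UNIV :: 'v set\<close> is given by its
  set of edges and loops \<open>E :: 'v uprod set\<close>; a loop at \<open>i\<close> is \<^term>\<open>Upair i i\<close>.
\<close>

definition loops :: "'v uprod set \<Rightarrow> 'v set" where
  "loops E = {i. Upair i i \<in> E}"

text \<open>A vertex carrying a loop is not isolated.\<close>

definition no_isolated_vertex :: "'v uprod set \<Rightarrow> bool" where
  "no_isolated_vertex E \<longleftrightarrow> (\<forall>i. \<exists>j. Upair i j \<in> E)"

text \<open>Condition \<open>(*)\<close>.\<close>

definition loops_adjacent :: "'v uprod set \<Rightarrow> bool" where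
  "loops_adjacent E \<longleftrightarrow> (\<forall>i\<in>loops E. \<forall>j\<in>loops E. Upair i j \<in> E)"

definition induced :: "'v uprod set \<Rightarrow> 'v set \<Rightarrow> 'v uprod set" where
  "induced E W = {e \<in> E. set_uprod e \<subseteq> W}"

text \<open>\<open>E\<close> is the complete bipartite graph on the vertex set \<open>W\<close> with parts \<open>V1\<close> and \<open>V2\<close>.\<close>

definition complete_bipartite :: "'v uprod set \<Rightarrow> 'v set \<Rightarrow> 'v set \<Rightarrow> 'v set \<Rightarrow> bool" where
  "complete_bipartite E W V1 V2 \<longleftrightarrow>
     V1 \<noteq> {} \<and> V2 \<noteq> {} \<and> V1 \<inter> V2 = {} \<and> V1 \<union> V2 = W \<and>
     E = {Upair i j | i j. i \<in> V1 \<and> j \<in> V2}"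

definition has_4_cycle :: "'v uprod set \<Rightarrow> bool" where
  "has_4_cycle E \<longleftrightarrow>
     (\<exists>a b c d. distinct [a, b, c, d] \<and> {Upair a b, Upair b c, Upair c d, Upair d a} \<subseteq> E)"


section \<open>Edge polytopes\<close>

lift_definition edge_point :: "'v::finite uprod \<Rightarrow> real ^ 'v" is
  "\<lambda>(i, j). axis i 1 + axis j 1"
  by (auto simp: add.commute)

definition edge_polytope :: "'v::finite uprod set \<Rightarrow> (real ^ 'v) set" where
  "edge_polytope E = convex hull (edge_point ` E)"

definition simple_polytope :: "'a::euclidean_space set \<Rightarrow> bool" where
  "simple_polytope P \<longleftrightarrow> polytope P \<and>
     (\<forall>v. v extreme_point_of P \<longrightarrow> int (card {F. F edge_of P \<and> v \<in> F}) = aff_dim P)"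


section \<open>The labelling of the vertices\<close>

text \<open>
  The four types of graphs. The sets passed as arguments are the ones whose labels are
  prescribed by the labelling convention.
\<close>

definition type_alpha :: "'v uprod set \<Rightarrow> 'v set \<Rightarrow> 'v set \<Rightarrow> bool" where
  "type_alpha E V1 V2 \<longleftrightarrow> complete_bipartite E UNIV V1 V2 \<and> has_4_cycle E"

definition type_beta :: "'v uprod set \<Rightarrow> 'v \<Rightarrow> 'v set \<Rightarrow> 'v set \<Rightarrow> bool" where
  "type_beta E v V1 V2 \<longleftrightarrow>
     loops E = {v} \<and>
     complete_bipartite (induced E (- loops E)) (- loops E) V1 V2 \<and>
     (\<forall>w \<in> - loops E. Upair v w \<in> E)"

definition type_gamma :: "'v::finite uprod set \<Rightarrow> bool" where
  "type_gamma E \<longleftrightarrow>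
     card (loops E) \<ge> 2 \<and> - loops E \<noteq> {} \<and> induced E (- loops E) = {} \<and>
     (\<forall>v \<in> loops E. \<forall>w \<in> - loops E. Upair v w \<in> E)"

definition type_simplex :: "'v::finite uprod set \<Rightarrow> bool" where
  "type_simplex E \<longleftrightarrow> (\<exists>n. n simplex edge_polytope E) \<and> card (loops E) \<ge> 2"

text \<open>
  \<open>lab\<close> is the labelling of the vertices by \<open>1, \<dots>, d\<close>. That a graph with simple edge polytope
  and nonzero toric ideal is of one of the four types is a theorem and not part of the
  convention, so each clause is conditional on the graph being of the respective type.
\<close>

definition labelling :: "'v::finite uprod set \<Rightarrow> ('v \<Rightarrow> nat) \<Rightarrow> bool" where
  "labelling E lab \<longleftrightarrow> bij_betw lab UNIV {1..CARD('v)} \<and>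
     ((\<exists>V1 V2. type_alpha E V1 V2) \<longrightarrow>
        (\<exists>V1 V2 m. type_alpha E V1 V2 \<and> lab ` V1 = {1..m} \<and> lab ` V2 = {m+1..CARD('v)})) \<and>
     ((\<exists>v V1 V2. type_beta E v V1 V2) \<longrightarrow>
        (\<exists>v V1 V2 m. type_beta E v V1 V2 \<and>
           lab v = 1 \<and> lab ` V1 = {2..m} \<and> lab ` V2 = {m+1..CARD('v)})) \<and>
     (type_gamma E \<longrightarrow>
        (\<exists>m. lab ` loops E = {1..m} \<and> lab ` (- loops E) = {m+1..CARD('v)})) \<and>
     (type_simplex E \<longrightarrow> (\<exists>m. lab ` loops E = {1..m}))"


section \<open>Polynomials and toric ideals\<close>

text \<open>Monomials are exponent functions; polynomials are finitely supported functions on monomials.\<close>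

type_synonym 'x monomial = "'x \<Rightarrow>\<^sub>0 nat"
type_synonym ('x, 'k) mpoly = "'x monomial \<Rightarrow>\<^sub>0 'k"

definition monom :: "'x monomial \<Rightarrow> ('x, 'k::field) mpoly" where
  "monom u = Poly_Mapping.single u 1"

definition var :: "'x \<Rightarrow> ('x, 'k::field) mpoly" where
  "var x = monom (Poly_Mapping.single x 1)"

text \<open>The polynomial ring in the variables from \<open>X\<close>.\<close>

definition poly_ring :: "'x set \<Rightarrow> ('x, 'k::field) mpoly set" where
  "poly_ring X = {p. \<forall>u \<in> Poly_Mapping.keys p. Poly_Mapping.keys u \<subseteq> X}"

text \<open>The homomorphism of algebras over the coefficient field sending each variable \<open>x\<close> to \<open>f x\<close>.\<close>

definition eval_hom :: "('x \<Rightarrow> ('y, 'k::field) mpoly) \<Rightarrow> ('x, 'k) mpoly \<Rightarrow> ('y, 'k) mpoly" where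
  "eval_hom f p =
     (\<Sum>u \<in> Poly_Mapping.keys p. Poly_Mapping.single 0 (Poly_Mapping.lookup p u) *
        (\<Prod>x \<in> Poly_Mapping.keys u. f x ^ Poly_Mapping.lookup u x))"

lift_definition edge_monomial :: "'v uprod \<Rightarrow> ('v, 'k::field) mpoly" is
  "\<lambda>(i, j). var i * var j"
  by (auto simp: mult.commute)

definition toric_ideal :: "'v uprod set \<Rightarrow> ('v uprod, 'k::field) mpoly set" where
  "toric_ideal E = {p \<in> poly_ring E. eval_hom edge_monomial p = 0}"


section \<open>Monomial orders and reduced Groebner bases\<close>

text \<open>
  The strict lexicographic order on the monomials in the variables from \<open>X\<close> induced by the strict
  linear order \<open>r\<close> of \<open>X\<close>, where \<open>(x, y) \<in> r\<close> means that \<open>x\<close> is smaller than \<open>y\<close>: the greatest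
  variable in which the exponents differ decides.
\<close>

definition lex_less :: "'x set \<Rightarrow> 'x rel \<Rightarrow> 'x monomial \<Rightarrow> 'x monomial \<Rightarrow> bool" where
  "lex_less X r u v \<longleftrightarrow>
     (\<exists>x \<in> X. Poly_Mapping.lookup u x < Poly_Mapping.lookup v x \<and>
        (\<forall>y \<in> X. (x, y) \<in> r \<longrightarrow> Poly_Mapping.lookup u y = Poly_Mapping.lookup v y))"

text \<open>The orders of the variables that are admitted; the order among the loops is arbitrary.\<close>

definition admissible_var_order :: "'v uprod set \<Rightarrow> ('v \<Rightarrow> nat) \<Rightarrow> 'v uprod rel \<Rightarrow> bool" where
  "admissible_var_order E lab r \<longleftrightarrow>
     strict_linear_order_on E r \<and>
     (\<forall>i k l. Upair i i \<in> E \<and> Upair k l \<in> E \<and> lab k < lab l \<longrightarrow> (Upair k l, Upair i i) \<in> r) \<and>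
     (\<forall>i j k l. Upair i j \<in> E \<and> Upair k l \<in> E \<and> lab i < lab j \<and> lab k < lab l \<longrightarrow>
        ((Upair i j, Upair k l) \<in> r \<longleftrightarrow> lab i < lab k \<or> lab i = lab k \<and> lab j > lab l))"

text \<open>Only meaningful for \<open>p \<noteq> 0\<close>.\<close>

definition initial_monomial ::
    "('x monomial \<Rightarrow> 'x monomial \<Rightarrow> bool) \<Rightarrow> ('x, 'k::field) mpoly \<Rightarrow> 'x monomial" where
  "initial_monomial lt p =
     (THE u. u \<in> Poly_Mapping.keys p \<and> (\<forall>v \<in> Poly_Mapping.keys p. v \<noteq> u \<longrightarrow> lt v u))"

text \<open>The ideal generated by \<open>S\<close> in the subring \<open>R\<close>.\<close>

definition ideal_generated :: "('x, 'k::field) mpoly set \<Rightarrow> ('x, 'k) mpoly set \<Rightarrow> ('x, 'k) mpoly set"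
  where "ideal_generated R S =
     {(\<Sum>s\<in>T. r s * s) | T r. finite T \<and> T \<subseteq> S \<and> (\<forall>s\<in>T. r s \<in> R)}"

definition groebner_basis ::
    "('x, 'k::field) mpoly set \<Rightarrow> ('x monomial \<Rightarrow> 'x monomial \<Rightarrow> bool) \<Rightarrow>
     ('x, 'k) mpoly set \<Rightarrow> ('x, 'k) mpoly set \<Rightarrow> bool" where
  "groebner_basis R lt I B \<longleftrightarrow>
     finite B \<and> B \<subseteq> I - {0} \<and>
     ideal_generated R ((\<lambda>f. monom (initial_monomial lt f)) ` B) =
     ideal_generated R ((\<lambda>f. monom (initial_monomial lt f)) ` (I - {0}))"

definition reduced_groebner_basis ::
    "('x, 'k::field) mpoly set \<Rightarrow> ('x monomial \<Rightarrow> 'x monomial \<Rightarrow> bool) \<Rightarrow>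
     ('x, 'k) mpoly set \<Rightarrow> ('x, 'k) mpoly set \<Rightarrow> bool" where
  "reduced_groebner_basis R lt I B \<longleftrightarrow>
     groebner_basis R lt I B \<and>
     (\<forall>g\<in>B. Poly_Mapping.lookup g (initial_monomial lt g) = 1) \<and>
     (\<forall>g\<in>B. \<forall>h\<in>B. g \<noteq> h \<longrightarrow>
        (\<forall>u \<in> Poly_Mapping.keys g. \<not> (\<exists>w. u = initial_monomial lt h + w)))"

definition monomial_degree :: "'x monomial \<Rightarrow> nat" where
  "monomial_degree u = (\<Sum>x \<in> Poly_Mapping.keys u. Poly_Mapping.lookup u x)"

text \<open>As usual for toric ideals, a binomial is a difference of two distinct monomials.\<close>

definition quadratic_binomial :: "('x, 'k::field) mpoly \<Rightarrow> bool" where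
  "quadratic_binomial g \<longleftrightarrow>
     (\<exists>u v. u \<noteq> v \<and> monomial_degree u = 2 \<and> monomial_degree v = 2 \<and> g = monom u - monom v)"

definition squarefree_monomial :: "'x monomial \<Rightarrow> bool" where
  "squarefree_monomial u \<longleftrightarrow> (\<forall>x. Poly_Mapping.lookup u x \<le> 1)"

end

theory Submission
  imports Defs
begin

text \<open>
  The toric ideal is determined by the fibres of the map from monomials in the edges to vertex
  degrees: a polynomial lies in it iff its coefficients sum to zero over every fibre. Suppose that,
  whenever two monomials of one fibre have no variable in common and \<open>e\<close> is the greatest variable
  in either, the monomial containing \<open>e\<close> also contains a variable \<open>f \<noteq> e\<close> such that \<open>e f\<close> lies in
  the fibre of some \<open>e' f'\<close> with \<open>e'\<close> and \<open>f'\<close> smaller than \<open>e\<close>. After cancelling common factors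
  this says that a monomial which is not the least one of its fibre is divisible by a squarefree
  quadratic initial monomial \<open>e f\<close>. Hence these products generate the initial ideal, each fibre
  contains at most one monomial divisible by none of them (a standard monomial), and a reduced
  Groebner basis can consist of nothing but the differences of the products \<open>e f\<close> and the standard
  monomials of their fibres. This is \<open>reduced_groebner_basis_quadratic_squarefree\<close>.

  To find \<open>f\<close> one has to know the graph. Attach to a vertex \<open>e\<close> of the edge polytope its star:
  \<open>e\<close> itself and the other ends of the polytope edges at \<open>e\<close>. The edge vectors of the star span those
  of all edges of the graph (\<open>star_spans\<close>), and if the polytope is simple there are just as many of
  them as the dimension of that span, so they are linearly independent (\<open>star_independent\<close>). On
  the other hand squares, triangles with a loop at a corner and similar subgraphs give linear
  relations between edge vectors. No star can contain such a subgraph, and applying this to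
  suitable vertices \<open>e\<close> forces the graph to be complete bipartite, a complete bipartite graph with a
  looped apex, or a looped clique joined to an independent set, unless the vertices of the polytope
  are linearly independent altogether (\<open>classification\<close>).

  In each of these cases \<open>f\<close> is found by comparing the two monomials through weights: a real
  function on the graph vertices, extended additively to edges, has the same total on both
  monomials of a fibre; so if it is nonnegative on one of them, and somewhere positive, it is
  positive somewhere on the other (\<open>exists_positive_weight\<close>). When the vertices of the polytope are
  linearly independent, disjoint monomials of one fibre involve only edges between looped vertices,
  and the graph may be replaced by its looped clique.
\<close>

section \<open>Monomial maps and their fibres\<close>

abbreviation keys where "keys \<equiv> Poly_Mapping.keys"
abbreviation lookup where "lookup \<equiv> Poly_Mapping.lookup"

text \<open>
  The image of \<open>u\<close> when every variable \<open>x\<close> is replaced by the monomial \<open>a x\<close>. The fibres of this map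
  are the classes of monomials with equal image.
\<close>

definition image_monomial :: "('x \<Rightarrow> 'y monomial) \<Rightarrow> 'x monomial \<Rightarrow> 'y monomial" where
  "image_monomial a u = (\<Sum>x\<in>keys u. Poly_Mapping.map ((*) (lookup u x)) (a x))"

lemma lookup_image_monomial:
  "lookup (image_monomial a u) y = (\<Sum>x\<in>keys u. lookup u x * lookup (a x) y)"
  unfolding image_monomial_def lookup_sum
  by (intro sum.cong) (auto simp: Poly_Mapping.map.rep_eq when_def)

lemma lookup_image_monomial_superset:
  assumes "finite X" "keys u \<subseteq> X"
  shows "lookup (image_monomial a u) y = (\<Sum>x\<in>X. lookup u x * lookup (a x) y)"
  unfolding lookup_image_monomial
  by (rule sum.mono_neutral_left) (use assms in \<open>auto simp: in_keys_iff\<close>)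

lemma image_monomial_add: "image_monomial a (u + v) = image_monomial a u + image_monomial a v"
proof (rule poly_mapping_eqI)
  fix y
  let ?X = "keys u \<union> keys v"
  have "keys (u + v) \<subseteq> ?X" by (rule Poly_Mapping.keys_add)
  then show "lookup (image_monomial a (u + v)) y = lookup (image_monomial a u + image_monomial a v) y"
    by (simp add: lookup_image_monomial_superset[of ?X] lookup_add distrib_right sum.distrib)
qed

lemma image_monomial_single: "image_monomial a (Poly_Mapping.single x 1) = a x"
  by (rule poly_mapping_eqI) (simp add: lookup_image_monomial)

lemma monom_mult: "monom u * monom v = (monom (u + v) :: ('x, 'k::field) mpoly)"
  by (simp add: monom_def mult_single)

lemma monom_zero: "monom 0 = (1 :: ('x, 'k::field) mpoly)"
  by (simp add: monom_def)

lemma monom_prod: "(\<Prod>x\<in>A. monom (f x)) = (monom (\<Sum>x\<in>A. f x) :: ('x, 'k::field) mpoly)"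
  by (induction A rule: infinite_finite_induct) (simp_all add: monom_mult monom_zero)

lemma monom_power: "monom u ^ n = (monom (Poly_Mapping.map ((*) n) u) :: ('x, 'k::field) mpoly)"
proof (induction n)
  case 0
  have "Poly_Mapping.map ((*) 0) u = 0"
    by (rule poly_mapping_eqI) (simp add: Poly_Mapping.map.rep_eq when_def)
  then show ?case by (simp only: power_0 monom_zero)
next
  case (Suc n)
  have "u + Poly_Mapping.map ((*) n) u = Poly_Mapping.map ((*) (Suc n)) u"
    by (rule poly_mapping_eqI) (simp add: Poly_Mapping.map.rep_eq when_def lookup_add)
  then show ?case by (simp only: power_Suc Suc monom_mult)
qed

lemma keys_monom [simp]: "keys (monom u :: ('x, 'k::field) mpoly) = {u}"
  by (simp add: monom_def)

lemma lookup_monom: "lookup (monom u :: ('x, 'k::field) mpoly) v = (if u = v then 1 else 0)"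
  by (simp add: monom_def lookup_single when_def)

lemma eval_hom_monomial:
  fixes p :: "('x, 'k::field) mpoly"
  shows "eval_hom (\<lambda>x. monom (a x)) p =
    (\<Sum>u\<in>keys p. Poly_Mapping.single (image_monomial a u) (lookup p u))"
  unfolding eval_hom_def
  by (rule sum.cong) (simp_all add: monom_power monom_prod image_monomial_def[symmetric],
      simp add: monom_def mult_single)

text \<open>
  The substitution sends monomials to monomials, so cancellation can only happen inside a fibre.
\<close>

lemma eval_hom_monomial_eq_0_iff:
  fixes p :: "('x, 'k::field) mpoly"
  shows "eval_hom (\<lambda>x. monom (a x)) p = 0 \<longleftrightarrow>
    (\<forall>w. (\<Sum>u\<in>{u\<in>keys p. image_monomial a u = w}. lookup p u) = 0)"
proof -
  have "lookup (eval_hom (\<lambda>x. monom (a x)) p) w =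
      (\<Sum>u\<in>{u\<in>keys p. image_monomial a u = w}. lookup p u)" for w
    by (simp add: eval_hom_monomial lookup_sum lookup_single when_def sum.If_cases Int_def)
  then show ?thesis
    by (metis lookup_zero poly_mapping_eqI)
qed

text \<open>
  A single nonzero coefficient cannot sum to zero, so each fibre met by a polynomial of the
  kernel is met at least twice.
\<close>

lemma fibre_partner:
  fixes p :: "('x, 'k::field) mpoly"
  assumes "eval_hom (\<lambda>x. monom (a x)) p = 0" "u \<in> keys p"
  shows "\<exists>v\<in>keys p. v \<noteq> u \<and> image_monomial a v = image_monomial a u"
proof (rule ccontr)
  assume "\<not> ?thesis"
  with assms(2) have "{v\<in>keys p. image_monomial a v = image_monomial a u} = {u}" by auto
  moreover have "(\<Sum>v\<in>{v\<in>keys p. image_monomial a v = image_monomial a u}. lookup p v) = 0"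
    using assms(1) unfolding eval_hom_monomial_eq_0_iff by blast
  ultimately show False using assms(2) by (simp add: in_keys_iff)
qed

lemma eval_hom_binomial:
  assumes "image_monomial a u = image_monomial a v"
  shows "eval_hom (\<lambda>x. monom (a x)) (monom u - monom v :: ('x, 'k::field) mpoly) = 0"
proof (cases "u = v")
  case True then show ?thesis by (simp add: eval_hom_def)
next
  case False
  have k: "keys (monom u - monom v :: ('x, 'k) mpoly) = {u, v}"
    using False by (auto simp: in_keys_iff lookup_minus lookup_monom split: if_splits)
  show ?thesis unfolding eval_hom_monomial k using False
    by (simp add: assms lookup_minus lookup_monom flip: single_add)
qed

section \<open>Polynomial rings, ideals and quadratic monomials\<close>

lemma poly_ring_add: "p \<in> poly_ring X \<Longrightarrow> q \<in> poly_ring X \<Longrightarrow> p + q \<in> poly_ring X"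
  unfolding poly_ring_def using Poly_Mapping.keys_add[of p q] by blast

lemma poly_ring_zero: "0 \<in> poly_ring X"
  by (simp add: poly_ring_def)

lemma poly_ring_sum: "(\<And>i. i \<in> A \<Longrightarrow> f i \<in> poly_ring X) \<Longrightarrow> (\<Sum>i\<in>A. f i) \<in> poly_ring X"
  by (induction A rule: infinite_finite_induct) (auto intro: poly_ring_add poly_ring_zero)

lemma poly_ring_mult: "p \<in> poly_ring X \<Longrightarrow> q \<in> poly_ring X \<Longrightarrow> p * q \<in> poly_ring X"
proof -
  assume p: "p \<in> poly_ring X" and q: "q \<in> poly_ring X"
  have "keys u \<subseteq> X" if "u \<in> keys (p * q)" for u
  proof -
    obtain v w where "u = v + w" "v \<in> keys p" "w \<in> keys q" using keys_mult[of p q] \<open>u \<in> keys (p * q)\<close> by blast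
    moreover have "keys v \<subseteq> X" "keys w \<subseteq> X" using p q calculation by (simp_all add: poly_ring_def)
    ultimately show ?thesis using Poly_Mapping.keys_add[of v w] by blast
  qed
  then show ?thesis by (simp add: poly_ring_def)
qed

lemma poly_ring_monom [simp]: "(monom u :: ('x, 'k::field) mpoly) \<in> poly_ring X \<longleftrightarrow> keys u \<subseteq> X"
  by (simp add: poly_ring_def)

lemma ideal_generated_monom_dvd:
  assumes "(monom m :: ('x, 'k::field) mpoly) \<in> ideal_generated R (monom ` A)"
  shows "\<exists>u\<in>A. \<exists>w. m = u + w"
proof -
  obtain T :: "('x, 'k) mpoly set" and c where T: "finite T" "T \<subseteq> monom ` A" "monom m = (\<Sum>s\<in>T. c s * s)"
    using assms unfolding ideal_generated_def by blast
  have "m \<in> keys (\<Sum>s\<in>T. c s * s)" by (simp flip: T(3))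
  then obtain s where s: "s \<in> T" "m \<in> keys (c s * s)"
    using keys_sum[of "\<lambda>s. c s * s" T] by blast
  then obtain u where u: "u \<in> A" "s = monom u" using T(2) by blast
  from s(2) keys_mult[of "c s" s] u obtain w where "m = w + u" by auto
  then show ?thesis using u(1) by (metis add.commute)
qed

text \<open>
  Adding multiples of generators as further generators does not enlarge an ideal. The combinations
  over \<open>S'\<close> have to be regrouped, since several elements of \<open>S'\<close> may be multiples of the same
  generator.
\<close>

lemma ideal_generated_eqI:
  fixes S S' :: "('x, 'k::field) mpoly set"
  assumes sub: "S \<subseteq> S'"
    and dvd: "\<And>s. s \<in> S' \<Longrightarrow> \<exists>c\<in>poly_ring X. \<exists>q\<in>S. s = c * q"
  shows "ideal_generated (poly_ring X) S = ideal_generated (poly_ring X) S'"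
proof
  show "ideal_generated (poly_ring X) S \<subseteq> ideal_generated (poly_ring X) S'"
    unfolding ideal_generated_def using sub by blast
  show "ideal_generated (poly_ring X) S' \<subseteq> ideal_generated (poly_ring X) S"
  proof
    fix p assume "p \<in> ideal_generated (poly_ring X) S'"
    then obtain T t where T: "finite T" "T \<subseteq> S'" "\<forall>s\<in>T. t s \<in> poly_ring X" "p = (\<Sum>s\<in>T. t s * s)"
      unfolding ideal_generated_def by blast
    obtain c q where cq: "\<And>s. s \<in> S' \<Longrightarrow> c s \<in> poly_ring X \<and> q s \<in> S \<and> s = c s * q s"
      using dvd by metis
    let ?t = "\<lambda>y. \<Sum>s\<in>{s\<in>T. q s = y}. t s * c s"
    have "p = (\<Sum>s\<in>T. t s * c s * q s)"
      unfolding T(4) using cq T(2) by (intro sum.cong) (auto simp: mult.assoc)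
    also have "\<dots> = (\<Sum>y\<in>q ` T. \<Sum>s\<in>{s\<in>T. q s = y}. t s * c s * q s)"
      by (rule sum.image_gen[OF T(1)])
    also have "\<dots> = (\<Sum>y\<in>q ` T. ?t y * y)"
      by (intro sum.cong) (auto simp: sum_distrib_right)
    finally have "p = (\<Sum>y\<in>q ` T. ?t y * y)" .
    moreover have "\<forall>y\<in>q ` T. ?t y \<in> poly_ring X"
      using cq T by (auto intro!: poly_ring_sum poly_ring_mult)
    moreover have "q ` T \<subseteq> S" using cq T(2) by blast
    ultimately show "p \<in> ideal_generated (poly_ring X) S"
      unfolding ideal_generated_def mem_Collect_eq using T(1) by (intro exI[of _ "q ` T"] exI[of _ ?t]) simp
  qed
qed

lemma monomial_degree_add: "monomial_degree (u + v) = monomial_degree u + monomial_degree v"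
proof -
  let ?X = "keys u \<union> keys v"
  have *: "monomial_degree w = (\<Sum>x\<in>?X. lookup w x)" if "keys w \<subseteq> ?X" for w
    unfolding monomial_degree_def by (rule sum.mono_neutral_left) (use that in \<open>auto simp: in_keys_iff\<close>)
  show ?thesis using Poly_Mapping.keys_add[of u v]
    by (simp add: * lookup_add sum.distrib)
qed

lemma monomial_degree_eq_0_iff: "monomial_degree u = 0 \<longleftrightarrow> u = 0"
  by (auto simp: monomial_degree_def in_keys_iff intro!: poly_mapping_eqI)

definition var_pair :: "'x \<Rightarrow> 'x \<Rightarrow> 'x monomial" where
  "var_pair x y = Poly_Mapping.single x 1 + Poly_Mapping.single y 1"

lemma lookup_var_pair: "lookup (var_pair x y) z = (if z = x then 1 else 0) + (if z = y then 1 else 0)"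
  by (simp add: var_pair_def lookup_add lookup_single when_def)

lemma keys_var_pair [simp]: "keys (var_pair x y) = {x, y}"
  by (auto simp: in_keys_iff lookup_var_pair split: if_splits)

lemma image_monomial_var_pair: "image_monomial a (var_pair x y) = a x + a y"
  unfolding var_pair_def image_monomial_add image_monomial_single ..

lemma monomial_degree_var_pair: "monomial_degree (var_pair x y) = 2"
  unfolding var_pair_def monomial_degree_add by (simp add: monomial_degree_def)

section \<open>Lexicographic orders and initial monomials\<close>

locale lex_order =
  fixes X :: "'x set" and r :: "'x rel"
  assumes fin: "finite X" and ord: "strict_linear_order_on X r"
begin

abbreviation less (infix \<open>\<prec>\<^sub>l\<close> 50) where "u \<prec>\<^sub>l v \<equiv> lex_less X r u v"

lemma r_trans: "(x, y) \<in> r \<Longrightarrow> (y, z) \<in> r \<Longrightarrow> (x, z) \<in> r"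
  using ord unfolding strict_linear_order_on_def by (meson transD)

lemma r_irrefl: "(x, x) \<notin> r"
  using ord unfolding strict_linear_order_on_def irrefl_def by blast

lemma r_asym: "(x, y) \<in> r \<Longrightarrow> (y, x) \<notin> r"
  using r_trans[of x y x] r_irrefl[of x] by auto

lemma r_total: "x \<in> X \<Longrightarrow> y \<in> X \<Longrightarrow> x \<noteq> y \<Longrightarrow> (x, y) \<in> r \<or> (y, x) \<in> r"
  using ord unfolding strict_linear_order_on_def total_on_def by blast

lemma exists_greatest_var:
  assumes "A \<subseteq> X" "A \<noteq> {}"
  shows "\<exists>x\<in>A. \<forall>y\<in>A. y \<noteq> x \<longrightarrow> (y, x) \<in> r"
proof -
  have "finite A" using assms fin finite_subset by blast
  moreover have "transp_on A (\<lambda>x y. (x, y) \<in> r)"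
    by (rule transp_onI) (rule r_trans)
  moreover have "asymp_on A (\<lambda>x y. (x, y) \<in> r)"
  proof (rule asymp_onI)
    show "(y, x) \<notin> r" if "(x, y) \<in> r" for x y
      using r_trans[OF that, of x] r_irrefl[of x] by auto
  qed
  ultimately obtain x where "x \<in> A" "\<forall>y\<in>A. y \<noteq> x \<longrightarrow> (x, y) \<notin> r"
    using Finite_Set.bex_max_element[of A] assms(2) by blast
  then show ?thesis using r_total assms(1) by blast
qed

lemma less_irrefl: "\<not> u \<prec>\<^sub>l u"
  unfolding lex_less_def by auto

lemma less_trans: "u \<prec>\<^sub>l v \<Longrightarrow> v \<prec>\<^sub>l w \<Longrightarrow> u \<prec>\<^sub>l w"
proof -
  assume "u \<prec>\<^sub>l v" "v \<prec>\<^sub>l w"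
  then obtain x y where x: "x \<in> X" "lookup u x < lookup v x"
      "\<And>z. z \<in> X \<Longrightarrow> (x, z) \<in> r \<Longrightarrow> lookup u z = lookup v z"
    and y: "y \<in> X" "lookup v y < lookup w y"
      "\<And>z. z \<in> X \<Longrightarrow> (y, z) \<in> r \<Longrightarrow> lookup v z = lookup w z"
    unfolding lex_less_def by blast
  \<comment> \<open>The greater of the two deciding variables decides.\<close>
  define z where "z = (if (x, y) \<in> r then y else x)"
  have "x = y \<or> (x, y) \<in> r \<or> (y, x) \<in> r" using r_total x(1) y(1) by blast
  then have "z \<in> X \<and> lookup u z < lookup w z \<and> (\<forall>t\<in>X. (z, t) \<in> r \<longrightarrow> lookup u t = lookup w t)"
  proof (elim disjE)
    assume "x = y"
    then show ?thesis using x y by (auto simp: z_def)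
  next
    assume xy: "(x, y) \<in> r"
    then have "lookup u t = lookup w t" if "t \<in> X" "(y, t) \<in> r" for t
      using x(3)[OF that(1) r_trans[OF xy that(2)]] y(3)[OF that] by simp
    then show ?thesis using x(3)[OF y(1) xy] y(1,2) xy by (simp add: z_def)
  next
    assume yx: "(y, x) \<in> r"
    then have "(x, y) \<notin> r" by (rule r_asym)
    moreover have "lookup u t = lookup w t" if "t \<in> X" "(x, t) \<in> r" for t
      using x(3)[OF that] y(3)[OF that(1) r_trans[OF yx that(2)]] by simp
    ultimately show ?thesis using y(3)[OF x(1) yx] x(1,2) by (simp add: z_def)
  qed
  then show "u \<prec>\<^sub>l w" unfolding lex_less_def by blast
qed

lemma less_asym: "u \<prec>\<^sub>l v \<Longrightarrow> \<not> v \<prec>\<^sub>l u"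
  using less_trans[of u v u] less_irrefl[of u] by auto

lemma asymp_less: "asymp_on A (lex_less X r)"
  by (rule asymp_onI) (rule less_asym)

lemma transp_less: "transp_on A (lex_less X r)"
  by (rule transp_onI) (rule less_trans)

lemma less_total:
  assumes "keys u \<subseteq> X" "keys v \<subseteq> X" "u \<noteq> v"
  shows "u \<prec>\<^sub>l v \<or> v \<prec>\<^sub>l u"
proof -
  let ?A = "{x\<in>X. lookup u x \<noteq> lookup v x}"
  obtain z where z: "lookup u z \<noteq> lookup v z" using assms(3) poly_mapping_eqI[of u v] by blast
  then have "z \<in> keys u \<or> z \<in> keys v" by (auto simp: in_keys_iff)
  then have "z \<in> ?A" using z assms(1,2) by auto
  then obtain x where x: "x \<in> ?A" "\<And>y. y \<in> ?A \<Longrightarrow> y \<noteq> x \<Longrightarrow> (y, x) \<in> r"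
    using exists_greatest_var[of ?A] by blast
  then have eq: "lookup u y = lookup v y" if "y \<in> X" "(x, y) \<in> r" for y
    using that r_asym[OF that(2)] x(2)[of y] r_irrefl[of x] by auto
  consider "lookup u x < lookup v x" | "lookup v x < lookup u x"
    using x(1) by fastforce
  then show ?thesis
    unfolding lex_less_def using x(1) eq by cases (auto intro!: bexI[of _ x])
qed

text \<open>
  The order is compatible with divisibility; this rules out that a trailing term of a polynomial is
  a proper multiple of its initial monomial.
\<close>

lemma less_add_nonzero:
  assumes "keys w \<subseteq> X" "w \<noteq> 0"
  shows "u \<prec>\<^sub>l u + w"
proof -
  have "keys w \<noteq> {}" using assms(2) by (metis keys_eq_empty)
  then obtain x where x: "x \<in> keys w" "\<forall>y\<in>keys w. y \<noteq> x \<longrightarrow> (y, x) \<in> r"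
    using exists_greatest_var[OF assms(1)] by blast
  then have "lookup w y = 0" if "(x, y) \<in> r" for y
    using that x(2) r_asym[of x y] r_irrefl[of x] by (auto simp: in_keys_iff)
  then show ?thesis using x(1) assms(1) unfolding lex_less_def
    by (intro bexI[of _ x]) (auto simp: lookup_add in_keys_iff)
qed

lemma initial_monomial_eqI:
  assumes "u \<in> keys p" "\<And>v. v \<in> keys p \<Longrightarrow> v \<noteq> u \<Longrightarrow> v \<prec>\<^sub>l u"
  shows "initial_monomial (lex_less X r) p = u"
  unfolding initial_monomial_def
proof (rule the_equality)
  fix v assume v: "v \<in> keys p \<and> (\<forall>w\<in>keys p. w \<noteq> v \<longrightarrow> w \<prec>\<^sub>l v)"
  show "v = u"
  proof (rule ccontr)
    assume "v \<noteq> u"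
    then have "v \<prec>\<^sub>l u" "u \<prec>\<^sub>l v" using v assms by auto
    then show False using less_asym by blast
  qed
qed (use assms in auto)

lemma initial_monomial:
  fixes p :: "('x, 'k::field) mpoly"
  assumes "p \<in> poly_ring X" "p \<noteq> 0"
  shows "initial_monomial (lex_less X r) p \<in> keys p"
    and "\<And>v. v \<in> keys p \<Longrightarrow> v \<noteq> initial_monomial (lex_less X r) p \<Longrightarrow> v \<prec>\<^sub>l initial_monomial (lex_less X r) p"
proof -
  obtain u where u: "u \<in> keys p" "\<forall>v\<in>keys p. v \<noteq> u \<longrightarrow> \<not> u \<prec>\<^sub>l v"
    using Finite_Set.bex_max_element[OF _ asymp_less transp_less, of "keys p"] assms(2) by auto
  then have u2: "\<forall>v\<in>keys p. v \<noteq> u \<longrightarrow> v \<prec>\<^sub>l u"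
    using less_total[of _ u] assms(1) u(1) by (auto simp: poly_ring_def)
  then have "initial_monomial (lex_less X r) p = u" using u(1) by (intro initial_monomial_eqI) auto
  then show "initial_monomial (lex_less X r) p \<in> keys p"
    and "\<And>v. v \<in> keys p \<Longrightarrow> v \<noteq> initial_monomial (lex_less X r) p \<Longrightarrow> v \<prec>\<^sub>l initial_monomial (lex_less X r) p"
    using u u2 by auto
qed

lemma initial_monomial_binomial:
  assumes "v \<prec>\<^sub>l u"
  shows "initial_monomial (lex_less X r) (monom u - monom v :: ('x, 'k::field) mpoly) = u"
    and "keys (monom u - monom v :: ('x, 'k) mpoly) = {u, v}"
proof -
  have "u \<noteq> v" using assms less_irrefl by blast
  then show k: "keys (monom u - monom v :: ('x, 'k) mpoly) = {u, v}"
    by (auto simp: in_keys_iff lookup_minus lookup_monom split: if_splits)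
  show "initial_monomial (lex_less X r) (monom u - monom v :: ('x, 'k::field) mpoly) = u"
    by (rule initial_monomial_eqI) (use assms in \<open>auto simp: k\<close>)
qed

end

section \<open>A criterion for quadratic squarefree Groebner bases\<close>

lemma ideal_generated_superset:
  fixes S :: "('x, 'k::field) mpoly set"
  assumes "s \<in> S"
  shows "s \<in> ideal_generated (poly_ring X) S"
proof -
  have "(1 :: ('x, 'k) mpoly) \<in> poly_ring X" by (simp add: poly_ring_def)
  then show ?thesis
    unfolding ideal_generated_def mem_Collect_eq using assms
    by (intro exI[of _ "{s}"] exI[of _ "\<lambda>_. 1"]) simp
qed

text \<open>
  The hypothesis under which the kernel of a monomial substitution has a quadratic Groebner basis
  with squarefree initial monomials. It only speaks about disjoint monomials \<open>u\<close> and \<open>v\<close> and their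
  greatest variable \<open>e\<close>; since both replacement variables are smaller than \<open>e\<close>, the product
  \<open>e f\<close> is automatically greater than \<open>e' f'\<close>.
\<close>

locale quadratically_reducible = lex_order X r for X :: "'x set" and r +
  fixes a :: "'x \<Rightarrow> 'y monomial"
  assumes homogeneous: "keys u \<subseteq> X \<Longrightarrow> keys v \<subseteq> X \<Longrightarrow>
      image_monomial a u = image_monomial a v \<Longrightarrow> monomial_degree u = monomial_degree v"
    and reduce: "keys u \<subseteq> X \<Longrightarrow> keys v \<subseteq> X \<Longrightarrow> image_monomial a u = image_monomial a v \<Longrightarrow>
      keys u \<inter> keys v = {} \<Longrightarrow> e \<in> keys u \<Longrightarrow> (\<And>g. g \<in> keys u \<union> keys v \<Longrightarrow> g \<noteq> e \<Longrightarrow> (g, e) \<in> r) \<Longrightarrow>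
      \<exists>f e' f'. f \<in> keys u \<and> f \<noteq> e \<and> e' \<in> X \<and> f' \<in> X \<and> (e', e) \<in> r \<and> (f', e) \<in> r \<and>
        a e + a f = a e' + a f'"
begin

definition reducible_pairs :: "'x monomial set" where
  "reducible_pairs = {q. \<exists>e f e' f'. e \<in> X \<and> f \<in> X \<and> e \<noteq> f \<and> e' \<in> X \<and> f' \<in> X \<and> q = var_pair e f \<and>
     a e + a f = a e' + a f' \<and> var_pair e' f' \<prec>\<^sub>l q}"

definition standard :: "'x monomial \<Rightarrow> bool" where
  "standard n \<longleftrightarrow> keys n \<subseteq> X \<and> (\<forall>q\<in>reducible_pairs. \<forall>w. n \<noteq> q + w)"

text \<open>
  The candidate for the reduced Groebner basis. By \<open>standard_unique\<close> there is at most one \<open>n\<close>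
  for each \<open>q\<close>.
\<close>

definition standard_binomials :: "('x, 'k::field) mpoly set" where
  "standard_binomials = {monom q - monom n | q n. q \<in> reducible_pairs \<and> standard n \<and>
     image_monomial a n = image_monomial a q}"

definition kernel :: "('x, 'k::field) mpoly set" where
  "kernel = {p \<in> poly_ring X. eval_hom (\<lambda>x. monom (a x)) p = 0}"

lemma reducible_pairs_keys: "q \<in> reducible_pairs \<Longrightarrow> keys q \<subseteq> X"
  unfolding reducible_pairs_def by auto

lemma reducible_pairs_degree: "q \<in> reducible_pairs \<Longrightarrow> monomial_degree q = 2"
  unfolding reducible_pairs_def by (auto simp: monomial_degree_var_pair)

lemma reducible_pairs_squarefree: "q \<in> reducible_pairs \<Longrightarrow> squarefree_monomial q"
  unfolding reducible_pairs_def squarefree_monomial_def by (auto simp: lookup_var_pair)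

lemma finite_reducible_pairs: "finite reducible_pairs"
  by (rule finite_subset[of _ "(\<lambda>(x, y). var_pair x y) ` (X \<times> X)"]) (auto simp: reducible_pairs_def fin)

lemma reducible_pairs_dvd_eq:
  assumes "q \<in> reducible_pairs" "monomial_degree p = 2" "p = q + w"
  shows "p = q"
  using assms reducible_pairs_degree[of q] by (simp add: monomial_degree_add monomial_degree_eq_0_iff)

text \<open>
  Cancelling the common part of \<open>u\<close> and \<open>v\<close> leaves disjoint monomials of one fibre. The variable
  that decides \<open>v \<prec>\<^sub>l u\<close> is then the greatest variable of either and occurs in the rest of \<open>u\<close>, so
  the reduction hypothesis applies.
\<close>

lemma reducible_pair_dvd:
  assumes u: "keys u \<subseteq> X" and v: "keys v \<subseteq> X" and eq: "image_monomial a u = image_monomial a v" and "v \<prec>\<^sub>l u"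
  shows "\<exists>q\<in>reducible_pairs. \<exists>w. keys w \<subseteq> X \<and> u = q + w"
proof -
  define c where "c = u - (u - v)"
  define u' v' where "u' = u - v" and "v' = v - u"
  have uc: "u = c + u'" and vc: "v = c + v'"
    unfolding c_def u'_def v'_def by (rule poly_mapping_eqI, simp add: lookup_add lookup_minus)+
  have ku: "keys u' \<subseteq> keys u" "keys v' \<subseteq> keys v"
    by (auto simp: u'_def v'_def in_keys_iff lookup_minus)
  have disj: "keys u' \<inter> keys v' = {}"
    by (auto simp: u'_def v'_def in_keys_iff lookup_minus)
  have eq': "image_monomial a u' = image_monomial a v'"
    using eq unfolding uc vc image_monomial_add by simp
  obtain x where x: "x \<in> X" "lookup v x < lookup u x" "\<And>y. y \<in> X \<Longrightarrow> (x, y) \<in> r \<Longrightarrow> lookup v y = lookup u y"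
    using \<open>v \<prec>\<^sub>l u\<close> unfolding lex_less_def by blast
  have xu: "x \<in> keys u'" using x(2) by (simp add: u'_def in_keys_iff lookup_minus)
  have top: "(g, x) \<in> r" if "g \<in> keys u' \<union> keys v'" "g \<noteq> x" for g
  proof -
    have "g \<in> X" using that ku u v by blast
    moreover have "lookup v g \<noteq> lookup u g"
      using that(1) by (auto simp: u'_def v'_def in_keys_iff lookup_minus)
    ultimately show ?thesis using x r_total that(2) by blast
  qed
  obtain f e' f' where f: "f \<in> keys u'" "f \<noteq> x" "e' \<in> X" "f' \<in> X" "(e', x) \<in> r" "(f', x) \<in> r"
      "a x + a f = a e' + a f'"
    using reduce[OF _ _ eq' disj xu top] ku u v by blast
  have less: "var_pair e' f' \<prec>\<^sub>l var_pair x f"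
  proof -
    have "lookup (var_pair e' f') x < lookup (var_pair x f) x"
      using f r_irrefl by (auto simp: lookup_var_pair)
    moreover have "lookup (var_pair e' f') y = lookup (var_pair x f) y" if "(x, y) \<in> r" for y
      using that f(5,6) top[of f] f(1,2) r_asym[of x y] r_irrefl[of x] by (auto simp: lookup_var_pair)
    ultimately show ?thesis using x(1) unfolding lex_less_def by blast
  qed
  have "var_pair x f \<in> reducible_pairs"
    unfolding reducible_pairs_def using f less x(1) ku u by blast
  moreover have "u = var_pair x f + (u - var_pair x f)"
  proof (rule poly_mapping_eqI)
    fix k
    have "lookup u x \<noteq> 0" "lookup u f \<noteq> 0"
      using subsetD[OF ku(1) xu] subsetD[OF ku(1) f(1)] unfolding in_keys_iff .
    then have "lookup (var_pair x f) k \<le> lookup u k"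
      using f(2) unfolding lookup_var_pair by (cases "k = x"; cases "k = f") simp_all
    then show "lookup u k = lookup (var_pair x f + (u - var_pair x f)) k"
      unfolding lookup_add lookup_minus by simp
  qed
  moreover have "keys (u - var_pair x f) \<subseteq> X"
    using u by (auto simp: in_keys_iff lookup_minus)
  ultimately show ?thesis by blast
qed

lemma standard_unique:
  assumes "standard u" "standard v" "image_monomial a u = image_monomial a v"
  shows "u = v"
  using assms less_total[of u v] reducible_pair_dvd[of u v] reducible_pair_dvd[of v u]
  unfolding standard_def by metis

text \<open>
  The least product of two variables in the fibre of \<open>q\<close> is standard: a reducible pair dividing it
  would have the same degree, hence be equal to it, and would not be least.
\<close>

lemma standard_form_exists:
  assumes q: "q \<in> reducible_pairs"
  shows "\<exists>n. standard n \<and> image_monomial a n = image_monomial a q \<and> n \<prec>\<^sub>l q"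
proof -
  let ?S = "{n \<in> (\<lambda>(x, y). var_pair x y) ` (X \<times> X). image_monomial a n = image_monomial a q}"
  have "finite ?S" using fin by simp
  moreover obtain n0 where n0: "n0 \<in> ?S" "n0 \<prec>\<^sub>l q"
    using q unfolding reducible_pairs_def by (fastforce simp: image_monomial_var_pair)
  ultimately obtain n where n: "n \<in> ?S" "\<forall>m\<in>?S. m \<noteq> n \<longrightarrow> \<not> m \<prec>\<^sub>l n"
    using Finite_Set.bex_min_element[OF _ asymp_less transp_less, of ?S] by blast
  have nX: "keys n \<subseteq> X" and deg: "monomial_degree n = 2" using n(1) by (auto simp: monomial_degree_var_pair)
  have "standard n"
    unfolding standard_def
  proof (intro conjI ballI allI nX notI)
    fix q' w assume q': "q' \<in> reducible_pairs" "n = q' + w"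
    then have "n = q'" using reducible_pairs_dvd_eq deg by blast
    with q'(1) n(1) obtain m where "m \<in> ?S" "m \<prec>\<^sub>l n"
      unfolding reducible_pairs_def by (fastforce simp: image_monomial_var_pair)
    moreover have "m \<noteq> n" using \<open>m \<prec>\<^sub>l n\<close> less_irrefl[of n] by blast
    ultimately show False using n(2) by blast
  qed
  moreover have "n \<prec>\<^sub>l q"
  proof (cases "n = n0")
    case False
    moreover have "keys n0 \<subseteq> X" using n0(1) by auto
    moreover have "\<not> n0 \<prec>\<^sub>l n" using bspec[OF n(2) n0(1)] False by blast
    ultimately have "n \<prec>\<^sub>l n0" using less_total[of n n0] nX by blast
    then show ?thesis using n0(2) by (rule less_trans)
  next
    case True
    then show ?thesis using n0(2) by (simp only:)
  qed
  ultimately show ?thesis using n(1) by blast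
qed

lemma standard_less:
  assumes "q \<in> reducible_pairs" "standard n" "image_monomial a n = image_monomial a q"
  shows "n \<prec>\<^sub>l q"
  using standard_form_exists[OF assms(1)] standard_unique assms(2,3) by metis

lemma standard_binomials_cases:
  fixes g :: "('x, 'k::field) mpoly"
  assumes "g \<in> standard_binomials"
  obtains q n where "q \<in> reducible_pairs" "standard n" "image_monomial a n = image_monomial a q"
    "n \<prec>\<^sub>l q" "g = monom q - monom n" "initial_monomial (lex_less X r) g = q" "keys g = {q, n}"
proof -
  obtain q n where q: "q \<in> reducible_pairs" "standard n" "image_monomial a n = image_monomial a q"
    "g = monom q - monom n"
    using assms unfolding standard_binomials_def by blast
  then have "n \<prec>\<^sub>l q" using standard_less by blast
  then show thesis using that q initial_monomial_binomial by metis
qed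

lemma kernel_initial_dvd:
  fixes p :: "('x, 'k::field) mpoly"
  assumes "p \<in> kernel" "p \<noteq> 0"
  shows "\<exists>q\<in>reducible_pairs. \<exists>w. keys w \<subseteq> X \<and> initial_monomial (lex_less X r) p = q + w"
proof -
  let ?u = "initial_monomial (lex_less X r) p"
  have p: "p \<in> poly_ring X" "eval_hom (\<lambda>x. monom (a x)) p = 0" using assms(1) by (auto simp: kernel_def)
  have u: "?u \<in> keys p" using initial_monomial(1)[OF p(1) assms(2)] .
  then obtain v where v: "v \<in> keys p" "v \<noteq> ?u" "image_monomial a v = image_monomial a ?u"
    using fibre_partner[OF p(2)] by blast
  moreover have "v \<prec>\<^sub>l ?u" using initial_monomial(2)[OF p(1) assms(2) v(1,2)] .
  moreover have "keys v \<subseteq> X" "keys ?u \<subseteq> X" using v(1) u p(1) by (auto simp: poly_ring_def)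
  ultimately show ?thesis using reducible_pair_dvd by metis
qed

lemma standard_binomials_subset: "(standard_binomials :: ('x, 'k::field) mpoly set) \<subseteq> kernel - {0}"
proof
  fix g :: "('x, 'k) mpoly" assume "g \<in> standard_binomials"
  then obtain q n where q: "q \<in> reducible_pairs" "standard n" "image_monomial a n = image_monomial a q"
      "g = monom q - monom n" "keys g = {q, n}" by (rule standard_binomials_cases)
  have "g \<in> poly_ring X"
    using q reducible_pairs_keys[OF q(1)] by (auto simp: poly_ring_def standard_def)
  moreover have "eval_hom (\<lambda>x. monom (a x)) g = 0"
    using eval_hom_binomial[OF q(3)[symmetric]] q(4) by simp
  moreover have "g \<noteq> 0" using q(5) by auto
  ultimately show "g \<in> kernel - {0}" by (simp add: kernel_def)
qed

lemma initial_monomials_standard_binomials: "initial_monomial (lex_less X r) ` (standard_binomials :: ('x, 'k::field) mpoly set) = reducible_pairs"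
proof (intro equalityI subsetI)
  fix q assume "q \<in> initial_monomial (lex_less X r) ` (standard_binomials :: ('x, 'k::field) mpoly set)"
  then obtain g :: "('x, 'k::field) mpoly" where g: "g \<in> standard_binomials" "q = initial_monomial (lex_less X r) g" by blast
  from g(1) show "q \<in> reducible_pairs" by (rule standard_binomials_cases) (simp add: g(2))
next
  fix q assume q: "q \<in> reducible_pairs"
  then obtain n where n: "standard n" "image_monomial a n = image_monomial a q" "n \<prec>\<^sub>l q"
    using standard_form_exists by blast
  then have "(monom q - monom n :: ('x, 'k::field) mpoly) \<in> standard_binomials" using q unfolding standard_binomials_def by blast
  then show "q \<in> initial_monomial (lex_less X r) ` (standard_binomials :: ('x, 'k::field) mpoly set)"
    using initial_monomial_binomial(1)[OF n(3)] by (metis imageI)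
qed

lemma standard_binomials_reduced_groebner_basis:
  "reduced_groebner_basis (poly_ring X) (lex_less X r) kernel (standard_binomials :: ('x, 'k::field) mpoly set)"
proof -
  let ?R = "poly_ring X :: ('x, 'k) mpoly set"
  let ?in = "initial_monomial (lex_less X r) :: ('x, 'k) mpoly \<Rightarrow> _"
  have "finite (standard_binomials :: ('x, 'k) mpoly set)"
  proof (rule finite_subset)
    show "(standard_binomials :: ('x, 'k) mpoly set) \<subseteq> (\<lambda>q. monom q -
        monom (THE n. standard n \<and> image_monomial a n = image_monomial a q)) ` reducible_pairs"
    proof
      fix g :: "('x, 'k) mpoly" assume "g \<in> standard_binomials"
      then obtain q n where q: "q \<in> reducible_pairs" "standard n" "image_monomial a n = image_monomial a q"
        "g = monom q - monom n" by (rule standard_binomials_cases)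
      then have "(THE n. standard n \<and> image_monomial a n = image_monomial a q) = n"
        by (intro the_equality) (auto intro: standard_unique)
      then show "g \<in> (\<lambda>q. monom q -
          monom (THE n. standard n \<and> image_monomial a n = image_monomial a q)) ` reducible_pairs"
        using q by auto
    qed
  qed (simp add: finite_reducible_pairs)
  moreover have "ideal_generated ?R ((\<lambda>f. monom (?in f)) ` standard_binomials) =
      ideal_generated ?R ((\<lambda>f. monom (?in f)) ` (kernel - {0}))"
  proof (rule ideal_generated_eqI)
    show "(\<lambda>f. monom (?in f)) ` standard_binomials \<subseteq> (\<lambda>f. monom (?in f)) ` (kernel - {0})"
      using standard_binomials_subset by (rule image_mono)
    fix s :: "('x, 'k) mpoly" assume "s \<in> (\<lambda>f. monom (?in f)) ` (kernel - {0})"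
    then obtain p where p: "p \<in> kernel" "p \<noteq> 0" "s = monom (?in p)" by blast
    then obtain q w where q: "q \<in> reducible_pairs" "keys w \<subseteq> X" "?in p = q + w"
      using kernel_initial_dvd by blast
    then have "monom q \<in> (\<lambda>f. monom (?in f)) ` standard_binomials"
      using initial_monomials_standard_binomials[where 'k='k] by (metis image_eqI image_image)
    moreover have "s = monom w * monom q" by (simp add: p(3) q(3) monom_mult add.commute)
    ultimately show "\<exists>c\<in>poly_ring X. \<exists>q\<in>(\<lambda>f. monom (?in f)) ` standard_binomials. s = c * q"
      using q(2) poly_ring_monom by blast
  qed
  moreover have "lookup g (?in g) = 1" if g: "g \<in> standard_binomials" for g
  proof -
    obtain q n where "n \<prec>\<^sub>l q" "g = monom q - monom n" and inq: "?in g = q" using g by (rule standard_binomials_cases)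
    moreover from this(1) have "n \<noteq> q" using less_irrefl[of q] by blast
    ultimately have "lookup g q = 1" by (simp add: lookup_minus lookup_monom)
    then show ?thesis unfolding inq .
  qed
  moreover have "\<not> (\<exists>w. u = ?in h + w)" if g: "g \<in> standard_binomials" and h: "h \<in> standard_binomials" and "g \<noteq> h" "u \<in> keys g" for g h u
  proof
    assume "\<exists>w. u = ?in h + w"
    then obtain w where w: "u = ?in h + w" by blast
    obtain q n where q: "q \<in> reducible_pairs" "standard n" "image_monomial a n = image_monomial a q"
      "g = monom q - monom n" "keys g = {q, n}" using g by (rule standard_binomials_cases)
    obtain q' n' where q': "q' \<in> reducible_pairs" "standard n'" "image_monomial a n' = image_monomial a q'"
      "h = monom q' - monom n'" "?in h = q'" using h by (rule standard_binomials_cases)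
    have "u \<noteq> n" using q(2) q'(1) w unfolding q'(5) standard_def by blast
    then have "u = q" using that(4) q(5) by simp
    then have "q = q'" using reducible_pairs_dvd_eq[OF q'(1) reducible_pairs_degree[OF q(1)]] w q'(5) by metis
    then have "n = n'" using standard_unique q(2,3) q'(2,3) by metis
    then show False using that(3) q(4) q'(4) \<open>q = q'\<close> by simp
  qed
  ultimately show ?thesis
    unfolding reduced_groebner_basis_def groebner_basis_def using standard_binomials_subset by blast
qed

text \<open>
  Let \<open>g\<close> be in a reduced Groebner basis. Its initial monomial is divisible by a reducible pair
  \<open>q\<close>, and \<open>q\<close> is in turn divisible by the initial monomial of some basis element, which must be
  \<open>g\<close> itself because the basis is reduced; so \<open>q\<close> is the initial monomial of \<open>g\<close>. All other terms of
  \<open>g\<close> are standard, hence in different fibres, and as no fibre is met only once there is just one,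
  in the fibre of \<open>q\<close>.
\<close>

lemma reduced_groebner_basis_unique:
  fixes B :: "('x, 'k::field) mpoly set"
  assumes B: "reduced_groebner_basis (poly_ring X) (lex_less X r) kernel B"
  shows "B = standard_binomials"
proof -
  let ?R = "poly_ring X :: ('x, 'k) mpoly set"
  let ?in = "initial_monomial (lex_less X r) :: ('x, 'k) mpoly \<Rightarrow> _"
  note B' = B[unfolded reduced_groebner_basis_def groebner_basis_def]
  have sub: "B \<subseteq> kernel - {0}"
    using B' by (elim conjE)
  have ideal: "ideal_generated ?R ((\<lambda>f. monom (?in f)) ` B) =
      ideal_generated ?R ((\<lambda>f. monom (?in f)) ` (kernel - {0}))"
    using B' by (elim conjE)
  have monic': "\<forall>g\<in>B. lookup g (?in g) = 1"
    using B' by (elim conjE)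
  have red': "\<forall>g\<in>B. \<forall>h\<in>B. g \<noteq> h \<longrightarrow> (\<forall>u\<in>keys g. \<not> (\<exists>w. u = ?in h + w))"
    using B' by (elim conjE)
  have monic: "lookup g (?in g) = 1" if "g \<in> B" for g
    using monic' that by (rule bspec)
  have red: "u \<noteq> ?in h + w" if "g \<in> B" "h \<in> B" "g \<noteq> h" "u \<in> keys g" for g h u w
    using red' that by blast
  have dvd: "\<exists>h\<in>B. \<exists>w. q = ?in h + w" if q: "q \<in> reducible_pairs" for q
  proof -
    have "q \<in> ?in ` standard_binomials" using q unfolding initial_monomials_standard_binomials .
    then obtain g :: "('x, 'k) mpoly" where g: "g \<in> standard_binomials" "q = ?in g" by (rule imageE)
    have "g \<in> kernel - {0}" using g(1) standard_binomials_subset by blast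
    then have "monom (?in g) \<in> (\<lambda>f. monom (?in f)) ` (kernel - {0})" by (rule imageI)
    then have "monom (?in g) \<in> ideal_generated ?R ((\<lambda>f. monom (?in f)) ` (kernel - {0}))"
      by (rule ideal_generated_superset)
    then have "monom q \<in> ideal_generated ?R ((\<lambda>f. monom (?in f)) ` B)"
      unfolding ideal g(2)[symmetric] .
    then have "(monom q :: ('x, 'k) mpoly) \<in> ideal_generated ?R (monom ` ?in ` B)"
      unfolding image_image .
    from ideal_generated_monom_dvd[OF this] show ?thesis unfolding bex_simps .
  qed
  have struct: "g \<in> standard_binomials" if g: "g \<in> B" for g
  proof -
    have gt: "g \<in> kernel" "g \<noteq> 0" using g sub by auto
    then have gp: "g \<in> poly_ring X" "eval_hom (\<lambda>x. monom (a x)) g = 0" by (auto simp: kernel_def)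
    obtain q w where q: "q \<in> reducible_pairs" "?in g = q + w"
      using kernel_initial_dvd[OF gt] by blast
    obtain h w' where h: "h \<in> B" "q = ?in h + w'" using dvd[OF q(1)] by blast
    have "?in g = ?in h + (w' + w)" using q(2) h(2) by (simp add: add.assoc)
    moreover have ing: "?in g \<in> keys g" using initial_monomial(1)[OF gp(1) gt(2)] .
    ultimately have "g = h" using red[OF g h(1)] by blast
    with \<open>?in g = ?in h + (w' + w)\<close> have "w' + w = 0" by simp
    then have "monomial_degree w' + monomial_degree w = 0"
      by (metis monomial_degree_add monomial_degree_eq_0_iff)
    then have inq: "?in g = q" using q(2) by (simp add: monomial_degree_eq_0_iff)
    have std: "standard u" if u: "u \<in> keys g" "u \<noteq> q" for u
      unfolding standard_def
    proof (intro conjI ballI allI notI)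
      show uX: "keys u \<subseteq> X" using gp(1) u(1) by (auto simp: poly_ring_def)
      fix q' w assume q': "q' \<in> reducible_pairs" "u = q' + w"
      obtain h' w'' where h': "h' \<in> B" "q' = ?in h' + w''" using dvd[OF q'(1)] by blast
      have u': "u = ?in h' + (w'' + w)" using q'(2) h'(2) by (simp add: add.assoc)
      then have "h' = g" using red[OF g h'(1) _ u(1)] by blast
      then have uq: "u = q + (w'' + w)" using u' inq by simp
      then have "w'' + w \<noteq> 0" using u(2) by auto
      moreover have "keys (w'' + w) \<subseteq> X"
        using uX unfolding uq by (auto simp: in_keys_iff lookup_add)
      ultimately have "q \<prec>\<^sub>l u" using less_add_nonzero uq by metis
      moreover have "u \<prec>\<^sub>l q" using initial_monomial(2)[OF gp(1) gt(2) u(1)] u(2) inq by simp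
      ultimately show False using less_asym by blast
    qed
    obtain n where n: "n \<in> keys g" "n \<noteq> q" "image_monomial a n = image_monomial a q"
      using fibre_partner[OF gp(2) ing] inq by auto
    have other: "u = n" if u: "u \<in> keys g" "u \<noteq> q" for u
    proof (rule ccontr)
      assume "u \<noteq> n"
      then have ne: "image_monomial a u \<noteq> image_monomial a n" using standard_unique std u n by metis
      obtain v where v: "v \<in> keys g" "v \<noteq> u" "image_monomial a v = image_monomial a u"
        using fibre_partner[OF gp(2) u(1)] by blast
      then have "v \<noteq> q" using ne n(3) by auto
      then show False using standard_unique std u v by metis
    qed
    have kg: "keys g = {q, n}" using other n(1) ing inq by blast
    have "(\<Sum>u\<in>{u\<in>keys g. image_monomial a u = image_monomial a q}. lookup g u) = 0"
      using gp(2) unfolding eval_hom_monomial_eq_0_iff by blast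
    moreover have "{u\<in>keys g. image_monomial a u = image_monomial a q} = {q, n}" using kg n(3) by auto
    ultimately have "lookup g q + lookup g n = 0" using n(2) by simp
    then have "lookup g n = - 1" "lookup g q = 1"
      using monic[OF g] inq by (simp_all add: eq_neg_iff_add_eq_0 add.commute)
    then have "g = monom q - monom n"
      using kg n(2) by (intro poly_mapping_eqI) (auto simp: lookup_minus lookup_monom in_keys_iff)
    then show ?thesis unfolding standard_binomials_def using q(1) std[OF n(1,2)] n(3) by blast
  qed
  show ?thesis
  proof (intro equalityI subsetI)
    fix g :: "('x, 'k) mpoly" assume "g \<in> standard_binomials"
    then obtain q n where q: "q \<in> reducible_pairs" "standard n" "image_monomial a n = image_monomial a q"
      "g = monom q - monom n" by (rule standard_binomials_cases)
    obtain h w where h: "h \<in> B" "q = ?in h + w" using dvd[OF q(1)] by blast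
    obtain q' n' where q': "q' \<in> reducible_pairs" "standard n'" "image_monomial a n' = image_monomial a q'"
      "h = monom q' - monom n'" "?in h = q'" using struct[OF h(1)] by (rule standard_binomials_cases)
    have "q = q'" using reducible_pairs_dvd_eq[OF q'(1) reducible_pairs_degree[OF q(1)]] h(2) q'(5) by metis
    then have "n = n'" using standard_unique q(2,3) q'(2,3) by metis
    then show "g \<in> B" using h(1) q(4) q'(4) \<open>q = q'\<close> by simp
  qed (rule struct)
qed

theorem reduced_groebner_basis_quadratic_squarefree:
  "(\<exists>!B :: ('x, 'k::field) mpoly set. reduced_groebner_basis (poly_ring X) (lex_less X r) kernel B) \<and>
   (\<forall>B :: ('x, 'k) mpoly set. reduced_groebner_basis (poly_ring X) (lex_less X r) kernel B \<longrightarrow>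
     (\<forall>g\<in>B. quadratic_binomial g \<and> squarefree_monomial (initial_monomial (lex_less X r) g)))"
proof (intro conjI allI impI ballI)
  show "\<exists>!B :: ('x, 'k::field) mpoly set. reduced_groebner_basis (poly_ring X) (lex_less X r) kernel B"
    using standard_binomials_reduced_groebner_basis reduced_groebner_basis_unique by blast
next
  fix B :: "('x, 'k) mpoly set" and g
  assume "reduced_groebner_basis (poly_ring X) (lex_less X r) kernel B" "g \<in> B"
  then have "g \<in> standard_binomials" using reduced_groebner_basis_unique by blast
  then obtain q n where q: "q \<in> reducible_pairs" "standard n" "image_monomial a n = image_monomial a q"
    "n \<prec>\<^sub>l q" "g = monom q - monom n" "initial_monomial (lex_less X r) g = q" by (rule standard_binomials_cases)
  show "squarefree_monomial (initial_monomial (lex_less X r) g)"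
    using reducible_pairs_squarefree q(1,6) by simp
  have "monomial_degree q = 2" by (rule reducible_pairs_degree[OF q(1)])
  moreover have "monomial_degree n = 2"
    using homogeneous[OF _ reducible_pairs_keys[OF q(1)] q(3)] q(2) calculation by (simp add: standard_def)
  moreover have "q \<noteq> n" using q(4) less_irrefl[of q] by blast
  ultimately show "quadratic_binomial g"
    unfolding quadratic_binomial_def using q(5) by blast
qed

end

section \<open>Edges of an edge polytope\<close>

lemma finite_uprod [simp]: "finite (A :: 'v::finite uprod set)"
  by (rule finite_subset[OF subset_UNIV]) simp

lemma edge_point_Upair [simp]: "edge_point (Upair i j) = axis i 1 + axis j 1"
  by transfer simp

lemma Upair_commute: "Upair i j = Upair j i"
  by simp

text \<open>
  The linear functional on edge vectors given by a weight of the graph vertices. The same weights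
  serve as supporting functionals of the polytope and as invariants of fibres.
\<close>

definition weight :: "('v::finite \<Rightarrow> real) \<Rightarrow> 'v uprod \<Rightarrow> real" where
  "weight w e = (\<chi> i. w i) \<bullet> edge_point e"

lemma weight_Upair [simp]: "weight w (Upair i j) = w i + w j"
  by (simp add: weight_def inner_add_right inner_axis)

lemma inj_edge_point: "inj (edge_point :: 'v::finite uprod \<Rightarrow> _)"
proof (rule injI)
  fix e f :: "'v uprod" assume eq: "edge_point e = edge_point f"
  have w: "weight w e = weight w f" for w by (simp add: weight_def eq)
  obtain i j k l where e: "e = Upair i j" and f: "f = Upair k l" by (metis uprod_exhaust)
  have "(if i = x then 1 else 0) + (if j = x then 1 else 0) =
      (if k = x then 1 else 0) + ((if l = x then 1 else 0) :: real)" for x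
    using w[of "\<lambda>y. if y = x then 1 else 0"] by (simp add: e f)
  from this[of i] this[of j] show "e = f" by (auto simp: e f split: if_splits)
qed

text \<open>
  For a graph satisfying the adjacency condition on loops these are the edges whose vectors are
  vertices of the edge polytope: the vector of an edge joining two looped vertices is the
  midpoint of the vectors of the two loops.
\<close>

definition vertex_edges :: "'v uprod set \<Rightarrow> 'v uprod set" where
  "vertex_edges E = {e \<in> E. \<forall>i j. e = Upair i j \<longrightarrow> i \<noteq> j \<longrightarrow> i \<in> loops E \<longrightarrow> j \<notin> loops E}"

definition neighbours :: "'v::finite uprod set \<Rightarrow> 'v uprod \<Rightarrow> 'v uprod set" where
  "neighbours E e =
     {f \<in> vertex_edges E - {e}. closed_segment (edge_point e) (edge_point f) edge_of edge_polytope E}"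

text \<open>
  Ends of polytope edges are taken geometrically. Which edges of the graph belong to the star is
  only ever needed in one direction, for the sufficient conditions derived below.
\<close>

definition star :: "'v::finite uprod set \<Rightarrow> 'v uprod \<Rightarrow> 'v uprod set" where
  "star E e = insert e (neighbours E e)"

lemma in_loops [simp]: "i \<in> loops E \<longleftrightarrow> Upair i i \<in> E"
  by (simp add: loops_def)

lemma vertex_edges_subset: "vertex_edges E \<subseteq> E"
  by (auto simp: vertex_edges_def)

lemma vertex_edges_loop: "Upair i i \<in> E \<Longrightarrow> Upair i i \<in> vertex_edges E"
  by (auto simp: vertex_edges_def)

lemma vertex_edges_Upair_iff:
  "i \<noteq> j \<Longrightarrow> Upair i j \<in> vertex_edges E \<longleftrightarrow> Upair i j \<in> E \<and> \<not> (Upair i i \<in> E \<and> Upair j j \<in> E)"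
  by (auto simp: vertex_edges_def)

lemma star_subset: "e \<in> vertex_edges E \<Longrightarrow> star E e \<subseteq> vertex_edges E"
  by (auto simp: star_def neighbours_def)

lemma in_star_sym: "e \<in> vertex_edges E \<Longrightarrow> f \<in> star E e \<Longrightarrow> e \<in> star E f"
  by (auto simp: star_def neighbours_def closed_segment_commute)

text \<open>
  A supporting functional cuts out a face, and a face of the convex hull of a finite set is the
  convex hull of the points of the set that it contains.
\<close>

lemma segment_edge_of_polytope:
  fixes E :: "'v::finite uprod set"
  assumes "e \<in> E" "f \<in> E" "e \<noteq> f" "weight w e = c" "weight w f = c"
    and le: "\<And>g. g \<in> E \<Longrightarrow> weight w g \<le> c"
    and eq: "\<And>g. g \<in> E \<Longrightarrow> weight w g = c \<Longrightarrow>
      edge_point g \<in> closed_segment (edge_point e) (edge_point f)"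
  shows "closed_segment (edge_point e) (edge_point f) edge_of edge_polytope E"
proof -
  let ?w = "\<chi> i. w i" and ?S = "edge_point ` E"
  let ?F = "convex hull ?S \<inter> {x. ?w \<bullet> x = c}"
  have "convex hull ?S \<subseteq> {x. ?w \<bullet> x \<le> c}"
    by (rule hull_minimal) (use le in \<open>auto simp: weight_def convex_halfspace_le\<close>)
  then have face: "?F face_of convex hull ?S"
    by (intro face_of_Int_supporting_hyperplane_le) auto
  obtain S' where S': "S' \<subseteq> ?S" "?F = convex hull S'"
    using face by (rule face_of_convex_hull_subset[rotated]) (auto intro: finite_imp_compact)
  have "S' \<subseteq> ?F" using S'(2) hull_subset by metis
  then have "S' \<subseteq> closed_segment (edge_point e) (edge_point f)"
    using S'(1) eq by (auto simp: weight_def)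
  then have "?F \<subseteq> closed_segment (edge_point e) (edge_point f)"
    unfolding S'(2) by (rule hull_minimal) simp
  moreover have "closed_segment (edge_point e) (edge_point f) \<subseteq> ?F"
    using assms(1-5) face_of_imp_convex[OF face, simplified]
    by (intro closed_segment_subset) (auto simp: weight_def hull_inc)
  ultimately have "closed_segment (edge_point e) (edge_point f) face_of edge_polytope E"
    using face unfolding edge_polytope_def by (metis subset_antisym)
  moreover have "edge_point e \<noteq> edge_point f" using inj_edge_point assms(3) by (metis injD)
  ultimately show ?thesis
    by (simp add: edge_of_def segment_convex_hull aff_dim_convex_hull aff_dim_2)
qed

text \<open>
  The midpoint is admitted because the segment between the vectors of two loops contains the vector
  of the edge joining their vertices.
\<close>

lemma in_starI:
  fixes E :: "'v::finite uprod set"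
  assumes "e \<in> vertex_edges E" "f \<in> vertex_edges E" "weight w e = c" "weight w f = c"
    and "\<And>x y. Upair x y \<in> E \<Longrightarrow> w x + w y \<le> c"
    and "\<And>x y. Upair x y \<in> E \<Longrightarrow> w x + w y = c \<Longrightarrow> Upair x y = e \<or> Upair x y = f \<or>
      edge_point (Upair x y) = midpoint (edge_point e) (edge_point f)"
  shows "f \<in> star E e"
proof (cases "e = f")
  case False
  have "closed_segment (edge_point e) (edge_point f) edge_of edge_polytope E"
  proof (rule segment_edge_of_polytope[where w = w and c = c])
    show "e \<in> E" "f \<in> E" using assms(1,2) vertex_edges_subset by auto
    show "weight w g \<le> c" if "g \<in> E" for g
      using assms(5) that by (cases g) auto
    show "edge_point g \<in> closed_segment (edge_point e) (edge_point f)" if g: "g \<in> E" "weight w g = c" for g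
    proof (cases g)
      case (Upair x y)
      then consider "g = e" | "g = f" | "edge_point g = midpoint (edge_point e) (edge_point f)"
        using assms(6)[of x y] g by (auto simp del: edge_point_Upair)
      then show ?thesis by cases (auto simp: midpoint_in_closed_segment)
    qed
  qed (use assms False in auto)
  then show ?thesis using False assms(2) by (auto simp: star_def neighbours_def)
qed (simp add: star_def)

subsection \<open>Pairs of vertices that span an edge\<close>

lemma star_loop_loop:
  assumes "Upair i i \<in> E" "Upair j j \<in> E"
  shows "Upair j j \<in> star E (Upair i i)"
proof (rule in_starI[where w = "\<lambda>x. if x = i \<or> x = j then 1 else -10" and c = 2])
  fix x y
  assume "(if x = i \<or> x = j then 1 else -10) + (if y = i \<or> y = j then 1 else -10 :: real) = 2"
  then have "x = i \<or> x = j" "y = i \<or> y = j" by (auto split: if_splits)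
  then show "Upair x y = Upair i i \<or> Upair x y = Upair j j \<or>
      edge_point (Upair x y) = midpoint (edge_point (Upair i i)) (edge_point (Upair j j))"
    by (auto simp: midpoint_def algebra_simps simp flip: scaleR_2)
qed (use assms in \<open>auto simp: vertex_edges_loop\<close>)

lemma star_loop_incident:
  assumes "Upair i i \<in> E" "Upair i j \<in> E" "Upair j j \<notin> E"
  shows "Upair i j \<in> star E (Upair i i)"
  by (rule in_starI[where w = "\<lambda>x. if x = i \<or> x = j then 1 else -10" and c = 2])
    (use assms in \<open>auto simp: vertex_edges_def split: if_splits\<close>)

text \<open>
  The weights below are \<open>1\<close> at \<open>i\<close> and add up to \<open>2\<close> on \<open>j, k\<close>; putting \<open>2\<close> on \<open>j\<close> and \<open>0\<close> on
  \<open>k\<close> is harmless as \<open>i\<close> and \<open>j\<close> are not adjacent. The value \<open>- 10\<close> off the vertices in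
  question excludes all other edges, here and in similar lemmas.
\<close>

lemma star_loop_disjoint:
  assumes la: "loops_adjacent E" and "Upair i i \<in> E" "Upair j k \<in> vertex_edges E" "i \<noteq> j" "i \<noteq> k" "j \<noteq> k"
    and "Upair i j \<notin> E"
  shows "Upair j k \<in> star E (Upair i i)"
proof -
  have "Upair j j \<notin> E" using la assms(2,7) by (auto simp: loops_adjacent_def)
  then show ?thesis
    by (intro in_starI[where w = "\<lambda>x. if x = i then 1 else if x = j then 2 else if x = k then 0 else -10" and c = 2])
      (use assms in \<open>auto simp: vertex_edges_loop Upair_commute split: if_splits\<close>)
qed

lemma star_incident:
  assumes "Upair i j \<in> vertex_edges E" "Upair i k \<in> vertex_edges E" "i \<noteq> j" "i \<noteq> k" "Upair i i \<notin> E"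
  shows "Upair i k \<in> star E (Upair i j)"
proof (cases "j = k")
  case False
  then show ?thesis
    by (intro in_starI[where w = "\<lambda>x. if x = i then 2 else if x = j then 0 else if x = k then 0 else -10" and c = 2])
      (use assms in \<open>auto simp: vertex_edges_loop Upair_commute split: if_splits\<close>)
qed (simp add: star_def)

lemma star_incident_at_loop:
  assumes "Upair i j \<in> vertex_edges E" "Upair i k \<in> vertex_edges E" "i \<noteq> j" "i \<noteq> k"
    "Upair i i \<in> E" "Upair j k \<notin> E"
  shows "Upair i k \<in> star E (Upair i j)"
proof (cases "j = k")
  case False
  then show ?thesis
    by (intro in_starI[where w = "\<lambda>x. if x = i then 0 else if x = j then 2 else if x = k then 2 else -10" and c = 2])
      (use assms in \<open>auto simp: vertex_edges_Upair_iff Upair_commute split: if_splits\<close>)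
qed (simp add: star_def)

text \<open>
  If two disjoint edges do not span an edge of the polytope, the sum of their vectors has a second
  expression by other edges on the same four vertices. The hypotheses exclude the two
  expressions by another perfect matching and the four with a loop at one of the vertices, half of
  it being added to half of the triangle on the other three.
  
  The weights \<open>1 \<plusminus> s\<close> on \<open>i, j\<close> and \<open>1 \<plusminus> t\<close> on \<open>k, l\<close> support the segment if certain signs of
  \<open>u = s + t\<close> and \<open>v = s - t\<close> and of \<open>u \<plusminus> v\<close> are the right ones. The sign conditions concern finitely
  many possibilities, and one of the eight points \<open>(\<plusminus>2, \<plusminus>1)\<close>, \<open>(\<plusminus>1, \<plusminus>2)\<close> always satisfies them.
\<close>

lemma star_disjoint:
  assumes la: "loops_adjacent E" and ij: "Upair i j \<in> vertex_edges E" and kl: "Upair k l \<in> vertex_edges E"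
    and d: "distinct [i, j, k, l]"
    and c: "\<not> (Upair i k \<in> E \<and> Upair j l \<in> E)" "\<not> (Upair i l \<in> E \<and> Upair j k \<in> E)"
    and t: "\<not> (Upair i i \<in> E \<and> Upair j k \<in> E \<and> Upair j l \<in> E)"
      "\<not> (Upair j j \<in> E \<and> Upair i k \<in> E \<and> Upair i l \<in> E)"
      "\<not> (Upair k k \<in> E \<and> Upair i l \<in> E \<and> Upair j l \<in> E)"
      "\<not> (Upair l l \<in> E \<and> Upair i k \<in> E \<and> Upair j k \<in> E)"
  shows "Upair k l \<in> star E (Upair i j)"
proof -
  have nl: "\<not> (Upair i i \<in> E \<and> Upair j j \<in> E)" "\<not> (Upair k k \<in> E \<and> Upair l l \<in> E)"
    using ij kl d by (simp_all add: vertex_edges_Upair_iff)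
  have ll: "Upair i i \<in> E \<Longrightarrow> Upair k k \<in> E \<Longrightarrow> Upair i k \<in> E"
     "Upair i i \<in> E \<Longrightarrow> Upair l l \<in> E \<Longrightarrow> Upair i l \<in> E"
     "Upair j j \<in> E \<Longrightarrow> Upair k k \<in> E \<Longrightarrow> Upair j k \<in> E"
     "Upair j j \<in> E \<Longrightarrow> Upair l l \<in> E \<Longrightarrow> Upair j l \<in> E"
    using la by (auto simp: loops_adjacent_def)
  define P where "P u v \<longleftrightarrow> (Upair i k \<in> E \<longrightarrow> u < 0) \<and> (Upair j l \<in> E \<longrightarrow> u > 0) \<and>
      (Upair i l \<in> E \<longrightarrow> v < 0) \<and> (Upair j k \<in> E \<longrightarrow> v > 0) \<and>
      (Upair i i \<in> E \<longrightarrow> u + v < 0) \<and> (Upair j j \<in> E \<longrightarrow> u + v > 0) \<and>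
      (Upair k k \<in> E \<longrightarrow> u - v < 0) \<and> (Upair l l \<in> E \<longrightarrow> u - v > 0) \<and>
      \<bar>u\<bar> \<le> 2 \<and> \<bar>v\<bar> \<le> 2" for u v :: real
  have "P 2 1 \<or> P 2 (-1) \<or> P (-2) 1 \<or> P (-2) (-1) \<or> P 1 2 \<or> P 1 (-2) \<or> P (-1) 2 \<or> P (-1) (-2)"
    unfolding P_def using c t nl ll by simp argo
  then obtain u v where "P u v" by blast
  then have P: "Upair i k \<in> E \<Longrightarrow> u < 0" "Upair j l \<in> E \<Longrightarrow> u > 0"
      "Upair i l \<in> E \<Longrightarrow> v < 0" "Upair j k \<in> E \<Longrightarrow> v > 0"
      "Upair i i \<in> E \<Longrightarrow> u + v < 0" "Upair j j \<in> E \<Longrightarrow> u + v > 0"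
      "Upair k k \<in> E \<Longrightarrow> u - v < 0" "Upair l l \<in> E \<Longrightarrow> u - v > 0" "\<bar>u\<bar> \<le> 2" "\<bar>v\<bar> \<le> 2"
    unfolding P_def by auto
  define w where "w x = (if x = i then 1 + (u + v) / 2 else if x = j then 1 - (u + v) / 2
      else if x = k then 1 + (u - v) / 2 else if x = l then 1 - (u - v) / 2 else -10)" for x
  have w: "w i = 1 + (u + v) / 2" "w j = 1 - (u + v) / 2" "w k = 1 + (u - v) / 2" "w l = 1 - (u - v) / 2"
    and w': "x \<notin> {i, j, k, l} \<Longrightarrow> w x = -10" and w3: "w x \<le> 3" for x
    using d P(9,10) by (auto simp: w_def abs_le_iff field_simps)
  have main: "w x + w y < 2 \<or> Upair x y = Upair i j \<or> Upair x y = Upair k l" if "Upair x y \<in> E" for x y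
  proof -
    consider "x \<notin> {i, j, k, l}" | "y \<notin> {i, j, k, l}" | "x \<in> {i, j, k, l}" "y \<in> {i, j, k, l}" by blast
    then show ?thesis
    proof cases
      case 1 then show ?thesis using w'[of x] w3[of y] by simp
    next
      case 2 then show ?thesis using w'[of y] w3[of x] by simp
    next
      case 3
      then show ?thesis using that P(1-8) d
        by (auto simp: w Upair_commute[of j i] Upair_commute[of k i] Upair_commute[of l i]
          Upair_commute[of k j] Upair_commute[of l j] Upair_commute[of l k] field_simps simp del: Upair_inject)
    qed
  qed
  show ?thesis
    by (rule in_starI[OF ij kl, where w = w and c = 2]) (use main w in force)+
qed

section \<open>Stars of vertices: spanning and, for simple polytopes, independent\<close>

lemma span_combination:
  fixes S :: "'a::real_vector set"
  shows "a \<in> span S \<Longrightarrow> b \<in> span S \<Longrightarrow> c \<in> span S \<Longrightarrow> x = a + b - c \<Longrightarrow> x \<in> span S"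
    and "a \<in> span S \<Longrightarrow> b \<in> span S \<Longrightarrow> x = (1/2) *\<^sub>R (a + b) \<Longrightarrow> x \<in> span S"
  by (simp_all add: span_add span_diff span_scale)

lemma star_span:
  assumes "f \<in> star E e"
  shows "edge_point f \<in> span (edge_point ` star E e)"
  using assms by (simp add: span_base)

text \<open>
  The vector of an edge with two looped ends is the midpoint of two loops, and all loops are in the star.
  Any other edge outside the star forms a triangle with the loop at \<open>i\<close>, so its vector is a combination of
  the other two sides and the loop.
\<close>

lemma star_span_loop:
  assumes la: "loops_adjacent E" and i: "Upair i i \<in> E" and f: "f \<in> E"
  shows "edge_point f \<in> span (edge_point ` star E (Upair i i))" (is "_ \<in> ?S")
proof -
  have loop: "edge_point (Upair k k) \<in> ?S" if "Upair k k \<in> E" for k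
    using star_span star_loop_loop i that by metis
  have loops: "edge_point (Upair k l) \<in> ?S" if "Upair k k \<in> E" "Upair l l \<in> E" for k l
    by (rule span_combination(2)[OF loop[OF that(1)] loop[OF that(2)]]) (simp add: algebra_simps flip: scaleR_2)
  have inc: "edge_point (Upair i k) \<in> ?S" if "Upair i k \<in> E" for k
    using star_span star_loop_incident i that loops by metis
  obtain j k where jk: "f = Upair j k" by (cases f)
  consider "j = k" | "i = j" | "i = k" | "Upair j j \<in> E" "Upair k k \<in> E"
    | "i \<noteq> j" "i \<noteq> k" "j \<noteq> k" "Upair j k \<in> vertex_edges E"
    using f jk by (auto simp: vertex_edges_Upair_iff)
  then show ?thesis
  proof cases
    case 1 then show ?thesis using loop f jk by auto
  next
    case 2 then show ?thesis using inc f jk by auto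
  next
    case 3 then show ?thesis using inc f jk by (metis Upair_commute)
  next
    case 4 then show ?thesis using loops jk by auto
  next
    case 5
    show ?thesis
    proof (cases "Upair i j \<in> E \<and> Upair i k \<in> E")
      case True
      show ?thesis
        by (rule span_combination(1)[OF inc[of j] inc[of k] loop[OF i]]) (use True jk in auto)
    next
      case False
      then have "Upair j k \<in> star E (Upair i i)"
        using star_loop_disjoint[OF la i] 5 by (metis Upair_commute)
      then show ?thesis using star_span jk by metis
    qed
  qed
qed

text \<open>
  The vectors are expressed in the order in which they depend on each other: edges at the loopless
  end \<open>j\<close>, the possible loop at \<open>i\<close>, other loops, edges at \<open>i\<close>, disjoint edges. For an edge outside
  the star one uses the relation that prevents it from being in the star.
\<close>

lemma star_span_edge:
  assumes la: "loops_adjacent E" and ij: "Upair i j \<in> vertex_edges E" "i \<noteq> j" "Upair j j \<notin> E" and f: "f \<in> E"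
  shows "edge_point f \<in> span (edge_point ` star E (Upair i j))" (is "_ \<in> ?S")
proof -
  have e: "edge_point (Upair i j) \<in> ?S" by (rule star_span) (simp add: star_def)
  have at_j: "edge_point (Upair j k) \<in> ?S" if "Upair j k \<in> E" for k
  proof (rule star_span)
    have "j \<noteq> k" using that ij(3) by auto
    then show "Upair j k \<in> star E (Upair i j)"
      using star_incident[of j i E k] ij that by (simp add: Upair_commute[of i j] vertex_edges_Upair_iff)
  qed
  have at_ii: "edge_point (Upair i i) \<in> ?S" if "Upair i i \<in> E"
    using star_span in_star_sym star_loop_incident[of i E j] that ij vertex_edges_loop vertex_edges_subset
    by (metis subsetD)
  have loop: "edge_point (Upair k k) \<in> ?S" if k: "Upair k k \<in> E" for k
  proof (cases "k = i")
    case False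
    have kj: "k \<noteq> j" using k ij(3) by auto
    show ?thesis
    proof (cases "Upair i k \<in> E \<and> Upair j k \<in> E")
      case True
      show ?thesis
      proof (cases "Upair i i \<in> E")
        case ii: True
        have "edge_point (Upair k k) = edge_point (Upair i i) + 2 *\<^sub>R edge_point (Upair j k) -
          2 *\<^sub>R edge_point (Upair i j)" by (simp add: vec_eq_iff)
        then show ?thesis using at_ii[OF ii] at_j[of k] True e by (metis span_add span_diff span_scale)
      next
        case ii: False
        have "Upair i k \<in> star E (Upair i j)"
          using star_incident[of i j E k] ij ii True False by (auto simp: vertex_edges_Upair_iff)
        then show ?thesis
          by (intro span_combination(1)[OF star_span at_j[of k] e]) (use True in auto)
      qed
    next
      case nt: False
      have "Upair i j \<in> star E (Upair k k)"
        using star_loop_disjoint[OF la k, of i j] star_loop_disjoint[OF la k, of j i] nt ij False kj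
        by (metis Upair_commute)
      then show ?thesis using star_span in_star_sym vertex_edges_loop k by metis
    qed
  qed (use at_ii k in simp)
  have loops: "edge_point (Upair k l) \<in> ?S" if "Upair k k \<in> E" "Upair l l \<in> E" for k l
    by (rule span_combination(2)[OF loop[OF that(1)] loop[OF that(2)]]) (simp add: algebra_simps flip: scaleR_2)
  have at_i: "edge_point (Upair i k) \<in> ?S" if k: "Upair i k \<in> E" for k
  proof -
    consider "k = i" | "k = j" | "k \<noteq> i" "k \<noteq> j" "Upair i i \<notin> E" | "Upair i i \<in> E" "Upair k k \<in> E"
      | "k \<noteq> i" "k \<noteq> j" "Upair i i \<in> E" "Upair k k \<notin> E" by blast
    then show ?thesis
    proof cases
      case 1 then show ?thesis using loop k by simp
    next
      case 2 then show ?thesis using e by simp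
    next
      case 3
      then have "Upair i k \<in> star E (Upair i j)"
        using star_incident[of i j E k] ij k by (auto simp: vertex_edges_Upair_iff)
      then show ?thesis by (rule star_span)
    next
      case 4 then show ?thesis using loops by blast
    next
      case 5
      show ?thesis
      proof (cases "Upair j k \<in> E")
        case True
        show ?thesis by (rule span_combination(1)[OF at_ii at_j[of k] e]) (use True 5 in auto)
      next
        case False
        then have "Upair i k \<in> star E (Upair i j)"
          using star_incident_at_loop[of i j E k] ij k 5 by (auto simp: vertex_edges_Upair_iff)
        then show ?thesis by (rule star_span)
      qed
    qed
  qed
  obtain k l where kl: "f = Upair k l" by (cases f)
  consider "k = l" | "k = i" | "l = i" | "k = j" | "l = j" | "Upair k k \<in> E" "Upair l l \<in> E"
    | "distinct [i, j, k, l]" "Upair k l \<in> vertex_edges E"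
    using f kl ij(2) by (auto simp: vertex_edges_Upair_iff)
  then show ?thesis
  proof cases
    case 1 then show ?thesis using loop f kl by auto
  next
    case 2 then show ?thesis using at_i f kl by auto
  next
    case 3 then show ?thesis using at_i f kl by (metis Upair_commute)
  next
    case 4 then show ?thesis using at_j f kl by auto
  next
    case 5 then show ?thesis using at_j f kl by (metis Upair_commute)
  next
    case 6 then show ?thesis using loops kl by auto
  next
    case 7
    consider "Upair i k \<in> E" "Upair j l \<in> E" | "Upair i l \<in> E" "Upair j k \<in> E"
      | "Upair i i \<in> E" "Upair j k \<in> E" "Upair j l \<in> E"
      | "Upair k k \<in> E" "Upair i l \<in> E" "Upair j l \<in> E"
      | "Upair l l \<in> E" "Upair i k \<in> E" "Upair j k \<in> E"
      | "Upair k l \<in> star E (Upair i j)"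
      using star_disjoint[OF la ij(1) 7(2) 7(1)] ij(3) by blast
    then show ?thesis
    proof cases
      case 1
      then show ?thesis by (intro span_combination(1)[OF at_i[of k] at_j[of l] e]) (auto simp: kl)
    next
      case 2
      then show ?thesis by (intro span_combination(1)[OF at_i[of l] at_j[of k] e]) (auto simp: kl)
    next
      case 3
      have "edge_point f = edge_point (Upair i i) + edge_point (Upair j k) + edge_point (Upair j l)
          - 2 *\<^sub>R edge_point (Upair i j)" by (simp add: kl vec_eq_iff)
      then show ?thesis using at_ii[OF 3(1)] at_j[OF 3(2)] at_j[OF 3(3)] e
        by (metis span_add span_diff span_scale)
    next
      case 4
      have "edge_point f = (1/2) *\<^sub>R (edge_point (Upair k k) + edge_point (Upair i l) + edge_point (Upair j l)
          - edge_point (Upair i j))" by (simp add: kl vec_eq_iff)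
      then show ?thesis using loop[OF 4(1)] at_i[OF 4(2)] at_j[OF 4(3)] e
        by (metis span_add span_diff span_scale)
    next
      case 5
      have "edge_point f = (1/2) *\<^sub>R (edge_point (Upair l l) + edge_point (Upair i k) + edge_point (Upair j k)
          - edge_point (Upair i j))" by (simp add: kl vec_eq_iff)
      then show ?thesis using loop[OF 5(1)] at_i[OF 5(2)] at_j[OF 5(3)] e
        by (metis span_add span_diff span_scale)
    next
      case 6 then show ?thesis using star_span kl by metis
    qed
  qed
qed

lemma star_spans:
  assumes la: "loops_adjacent E" and e: "e \<in> vertex_edges E"
  shows "edge_point ` E \<subseteq> span (edge_point ` star E e)"
proof -
  obtain i j where ij: "e = Upair i j" by (cases e)
  consider "i = j" | "i \<noteq> j" "Upair j j \<notin> E" | "i \<noteq> j" "Upair i i \<notin> E"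
    using e vertex_edges_Upair_iff[of i j E] unfolding ij by blast
  then show ?thesis
  proof cases
    case 1 then show ?thesis using star_span_loop[OF la] e ij vertex_edges_subset by blast
  next
    case 2 then show ?thesis using star_span_edge[OF la] e ij by blast
  next
    case 3 then show ?thesis using star_span_edge[OF la, of j i] e ij by (auto simp: Upair_commute[of j i] simp del: Upair_inject)
  qed
qed

text \<open>
  The edge vectors lie on the hyperplane of coordinate sum \<open>2\<close>, which misses the origin.
\<close>

lemma aff_dim_edge_polytope: "aff_dim (edge_polytope E) + 1 = int (dim (edge_point ` E))"
proof -
  let ?S = "edge_point ` E"
  let ?H = "{x. (\<chi> i. 1) \<bullet> x = (2 :: real)}"
  have "(\<chi> i. 1) \<bullet> edge_point e = (2 :: real)" for e :: "'a uprod"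
    using weight_Upair[of "\<lambda>_. 1"] by (cases e) (simp add: weight_def)
  then have "affine hull ?S \<subseteq> ?H"
    by (intro hull_minimal) (auto simp: affine_hyperplane)
  then have "0 \<notin> affine hull ?S" by auto
  then have "aff_dim ?S + 1 = aff_dim (insert 0 ?S)" by (simp add: aff_dim_insert)
  also have "\<dots> = int (dim (insert 0 ?S))" by (rule aff_dim_zero) (simp add: hull_inc)
  finally show ?thesis by (metis aff_dim_convex_hull dim_span edge_polytope_def span_insert_0)
qed

text \<open>
  Distinct neighbours give distinct polytope edges, so simplicity bounds the number of neighbours by
  the dimension of the polytope. Together with \<open>e\<close> there are then no more vectors than the
  dimension of the space that they span.
\<close>

lemma star_independent:
  fixes E :: "'v::finite uprod set"
  assumes la: "loops_adjacent E" and simple: "simple_polytope (edge_polytope E)" and e: "e \<in> vertex_edges E"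
  shows "independent (edge_point ` star E e)"
proof (cases "neighbours E e = {}")
  case True
  have "edge_point e \<noteq> 0"
  proof (cases e)
    case (Upair i j)
    then show ?thesis using weight_Upair[of "\<lambda>_. 1" i j] by (auto simp: weight_def)
  qed
  then show ?thesis using True by (simp add: star_def)
next
  case False
  let ?seg = "\<lambda>f. closed_segment (edge_point e) (edge_point f)"
  let ?edges = "{F. F edge_of edge_polytope E \<and> edge_point e \<in> F}"
  have poly: "polytope (edge_polytope E)" using simple by (simp add: simple_polytope_def)
  obtain f where "f \<in> neighbours E e" using False by blast
  then have "?seg f face_of edge_polytope E" by (simp add: neighbours_def edge_of_def)
  moreover have "{edge_point e} face_of ?seg f"
    by (simp add: face_of_singleton extreme_point_of_segment)
  ultimately have "edge_point e extreme_point_of edge_polytope E"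
    using face_of_trans face_of_singleton by blast
  then have edges: "int (card ?edges) = aff_dim (edge_polytope E)"
    using simple by (simp add: simple_polytope_def)
  have "finite ?edges"
    by (rule finite_subset[OF _ finite_polytope_faces[OF poly]]) (auto simp: edge_of_def)
  moreover have "?seg ` neighbours E e \<subseteq> ?edges" by (auto simp: neighbours_def)
  moreover have "inj_on ?seg (neighbours E e)"
    by (rule inj_onI) (use inj_edge_point in \<open>auto simp: closed_segment_eq doubleton_eq_iff dest: injD\<close>)
  ultimately have "card (neighbours E e) \<le> card ?edges"
    using card_mono card_image by metis
  moreover have "card (star E e) = card (neighbours E e) + 1"
    by (simp add: star_def neighbours_def)
  moreover have "card (edge_point ` star E e) \<le> card (star E e)" by (rule card_image_le) simp
  ultimately have "card (edge_point ` star E e) \<le> dim (edge_point ` E)"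
    using edges aff_dim_edge_polytope[of E] by linarith
  moreover have "edge_point ` star E e \<subseteq> edge_point ` E"
    using star_subset[OF e] vertex_edges_subset by blast
  ultimately show ?thesis
    by (intro card_le_dim_spanning[OF _ star_spans[OF la e]]) auto
qed

section \<open>Graphs with simple edge polytope\<close>

text \<open>
  The next lemmas list the relations between edge vectors that are used. Each comes from an even
  closed walk, a loop counting as a step: a square; a triangle and a loop at one of its corners;
  two loops joined by a path of two edges; a loop joined to a triangle by one edge.
\<close>

lemma independent_no_relation:
  assumes ind: "independent (edge_point ` S)" and "a \<in> S" "T \<subseteq> S" "a \<notin> T"
    and "edge_point a \<in> span (edge_point ` T)"
  shows False
proof -
  have "edge_point ` T \<subseteq> edge_point ` S - {edge_point a}"
    using assms(3,4) inj_edge_point by (auto dest: injD)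
  then have "edge_point a \<in> span (edge_point ` S - {edge_point a})"
    using assms(5) span_mono by blast
  then show False using ind assms(2) unfolding dependent_def by blast
qed

lemma independent_no_square:
  assumes "independent (edge_point ` S)" and "distinct [a, b, c, d]"
    and "Upair a b \<in> S" "Upair b c \<in> S" "Upair c d \<in> S" "Upair d a \<in> S"
  shows False
proof (rule independent_no_relation[OF assms(1)])
  let ?T = "{Upair b c, Upair c d, Upair d a}"
  have "edge_point (Upair a b) = edge_point (Upair b c) + edge_point (Upair d a) - edge_point (Upair c d)"
    by (simp add: algebra_simps)
  then show "edge_point (Upair a b) \<in> span (edge_point ` ?T)"
    by (metis (no_types, lifting) imageI insertCI span_add span_base span_diff)
qed (use assms in auto)

lemma independent_no_looped_triangle:
  assumes "independent (edge_point ` S)" and "distinct [i, j, k]"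
    and "Upair i i \<in> S" "Upair i j \<in> S" "Upair i k \<in> S" "Upair j k \<in> S"
  shows False
proof (rule independent_no_relation[OF assms(1)])
  let ?T = "{Upair i j, Upair i k, Upair j k}"
  have "edge_point (Upair i i) = edge_point (Upair i j) + edge_point (Upair i k) - edge_point (Upair j k)"
    by (simp add: algebra_simps)
  then show "edge_point (Upair i i) \<in> span (edge_point ` ?T)"
    by (metis (no_types, lifting) imageI insertCI span_add span_base span_diff)
qed (use assms in auto)

lemma independent_no_path_between_loops:
  assumes "independent (edge_point ` S)" and "distinct [p, q, j]"
    and "Upair p p \<in> S" "Upair q q \<in> S" "Upair j p \<in> S" "Upair j q \<in> S"
  shows False
proof (rule independent_no_relation[OF assms(1)])
  let ?T = "{Upair q q, Upair j p, Upair j q}"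
  have "edge_point (Upair p p) = edge_point (Upair q q) + 2 *\<^sub>R edge_point (Upair j p) - 2 *\<^sub>R edge_point (Upair j q)"
    by (simp add: vec_eq_iff)
  then show "edge_point (Upair p p) \<in> span (edge_point ` ?T)"
    by (metis (no_types, lifting) imageI insertCI span_add span_base span_diff span_scale)
qed (use assms in auto)

lemma independent_no_loop_edge_triangle:
  assumes "independent (edge_point ` S)" and "distinct [l, i, j, k]"
    and "Upair l l \<in> S" "Upair l j \<in> S" "Upair i j \<in> S" "Upair i k \<in> S" "Upair j k \<in> S"
  shows False
proof (rule independent_no_relation[OF assms(1)])
  let ?T = "{Upair l j, Upair i j, Upair i k, Upair j k}"
  have "edge_point (Upair l l) = 2 *\<^sub>R edge_point (Upair l j) + edge_point (Upair i k)
      - edge_point (Upair i j) - edge_point (Upair j k)"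
    by (simp add: vec_eq_iff)
  then show "edge_point (Upair l l) \<in> span (edge_point ` ?T)"
    by (metis (no_types, lifting) imageI insertCI span_add span_base span_diff span_scale)
qed (use assms in auto)

locale simple_edge_polytope =
  fixes E :: "'v::finite uprod set"
  assumes no_isolated: "no_isolated_vertex E" and la: "loops_adjacent E"
    and simple: "simple_polytope (edge_polytope E)"
begin

abbreviation adj :: "'v \<Rightarrow> 'v \<Rightarrow> bool" (infix "\<frown>" 50) where "x \<frown> y \<equiv> Upair x y \<in> E"

abbreviation looped :: "'v \<Rightarrow> bool" where "looped x \<equiv> Upair x x \<in> E"

lemma adj_sym: "x \<frown> y \<Longrightarrow> y \<frown> x"
  by (simp add: Upair_commute)

lemma loops_adj: "looped x \<Longrightarrow> looped y \<Longrightarrow> x \<frown> y"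
  using la by (auto simp: loops_adjacent_def)

lemma has_neighbour: "\<exists>y. x \<frown> y"
  using no_isolated by (auto simp: no_isolated_vertex_def)

lemma vertex_edgeI: "x \<frown> y \<Longrightarrow> \<not> looped x \<Longrightarrow> Upair x y \<in> vertex_edges E"
  by (cases "x = y") (auto simp: vertex_edges_Upair_iff)

lemma vertex_edgeI': "x \<frown> y \<Longrightarrow> \<not> looped y \<Longrightarrow> Upair x y \<in> vertex_edges E"
  by (cases "x = y") (auto simp: vertex_edges_Upair_iff)

lemma star_indep: "e \<in> vertex_edges E \<Longrightarrow> independent (edge_point ` star E e)"
  by (rule star_independent[OF la simple])

lemma independent_if_subset_star:
  assumes "e \<in> vertex_edges E" "F \<subseteq> star E e"
  shows "independent (edge_point ` F)"
  using independent_mono[OF star_indep[OF assms(1)] image_mono[OF assms(2)]] .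

lemma self_in_star: "e \<in> star E e"
  by (simp add: star_def)

lemma incident_in_star:
  assumes "x \<frown> y" "x \<frown> z" "\<not> looped x"
  shows "Upair x z \<in> star E (Upair x y)" "Upair z x \<in> star E (Upair x y)"
    "Upair x z \<in> star E (Upair y x)" "Upair z x \<in> star E (Upair y x)"
proof -
  have "x \<noteq> y" "x \<noteq> z" using assms by auto
  then show "Upair x z \<in> star E (Upair x y)"
    using star_incident[of x y E z] assms vertex_edgeI by blast
  then show "Upair z x \<in> star E (Upair x y)" "Upair x z \<in> star E (Upair y x)" "Upair z x \<in> star E (Upair y x)"
    by (simp_all add: Upair_commute)
qed

lemma loop_in_star:
  assumes "looped l" "x \<frown> y" "x \<noteq> y" "\<not> looped x \<or> \<not> looped y" "\<not> (l \<frown> x) \<or> \<not> (l \<frown> y)"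
  shows "Upair l l \<in> star E (Upair x y)" "Upair x y \<in> star E (Upair l l)"
proof -
  have v: "Upair x y \<in> vertex_edges E" using assms(2,4) vertex_edgeI vertex_edgeI' by blast
  have ne: "l \<noteq> x \<or> l \<noteq> y" using assms(3) by blast
  show "Upair x y \<in> star E (Upair l l)"
  proof (cases "l = x \<or> l = y")
    case True
    then show ?thesis using assms star_loop_incident[of l E x] star_loop_incident[of l E y]
      by (auto simp: Upair_commute)
  next
    case False
    then show ?thesis using star_loop_disjoint[OF la assms(1), of x y] star_loop_disjoint[OF la assms(1), of y x]
      v assms(3,5) Upair_commute[of x y] by metis
  qed
  then show "Upair l l \<in> star E (Upair x y)"
    by (rule in_star_sym[OF vertex_edges_loop[OF assms(1)]])
qed

lemma own_loop_in_star:
  assumes "looped l" "l \<frown> x" "\<not> looped x"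
  shows "Upair l l \<in> star E (Upair l x)" "Upair l l \<in> star E (Upair x l)"
proof -
  have "Upair l x \<in> star E (Upair l l)" using star_loop_incident assms by blast
  then show "Upair l l \<in> star E (Upair l x)" by (rule in_star_sym[OF vertex_edges_loop[OF assms(1)]])
  then show "Upair l l \<in> star E (Upair x l)" by (simp only: Upair_commute)
qed

lemma disjoint_in_star:
  assumes "w \<frown> x" "y \<frown> z" "distinct [w, x, y, z]" "\<not> looped w \<or> \<not> looped x" "\<not> looped y \<or> \<not> looped z"
    and "\<not> (w \<frown> y \<and> x \<frown> z)" "\<not> (w \<frown> z \<and> x \<frown> y)"
    and "\<not> (looped w \<and> x \<frown> y \<and> x \<frown> z)" "\<not> (looped x \<and> w \<frown> y \<and> w \<frown> z)"
      "\<not> (looped y \<and> w \<frown> z \<and> x \<frown> z)" "\<not> (looped z \<and> w \<frown> y \<and> x \<frown> y)"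
  shows "Upair y z \<in> star E (Upair w x)"
  by (rule star_disjoint[OF la]) (use assms vertex_edgeI vertex_edgeI' in blast)+

text \<open>
  Two common neighbours of \<open>x\<close> and \<open>y\<close> would give a square all of whose sides meet the edge
  \<open>x y\<close> in a loopless vertex, hence a square in its star.
\<close>

lemma common_neighbour_unique:
  assumes "x \<frown> y" "x \<noteq> y" "\<not> looped x" "\<not> looped y" "x \<frown> c" "y \<frown> c" "x \<frown> d" "y \<frown> d"
  shows "c = d"
proof (rule ccontr)
  assume "c \<noteq> d"
  moreover have "c \<noteq> x" "c \<noteq> y" "d \<noteq> x" "d \<noteq> y" using assms by auto
  ultimately have d: "distinct [x, c, y, d]" using assms(2) by auto
  show False
    by (rule independent_no_square[OF star_indep[of "Upair x y"] d])
      (use assms incident_in_star[of x y] incident_in_star[of y x] vertex_edgeI[of x y] adj_sym in auto)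
qed

subsection \<open>Graphs without loops\<close>

definition square :: "'v \<Rightarrow> 'v \<Rightarrow> 'v \<Rightarrow> 'v \<Rightarrow> bool" where
  "square a b c d \<longleftrightarrow> distinct [a, b, c, d] \<and> a \<frown> b \<and> b \<frown> c \<and> c \<frown> d \<and> d \<frown> a"

lemma square_rotate: "square a b c d \<Longrightarrow> square b c d a"
  unfolding square_def by auto

text \<open>
  Without squares any two edges span an edge of the polytope, so every star is the whole graph.
\<close>

lemma square_exists:
  assumes nl: "\<And>x. \<not> looped x" and dep: "dependent (edge_point ` E)"
  shows "\<exists>a b c d. square a b c d"
proof (rule ccontr)
  assume no: "\<nexists>a b c d. square a b c d"
  obtain e where e: "e \<in> E" using dep unfolding dependent_def by blast
  obtain w x where wx: "e = Upair w x" by (cases e)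
  have wx': "w \<frown> x" "w \<noteq> x" using e wx nl by auto
  have "E \<subseteq> star E e"
  proof
    fix f assume f: "f \<in> E"
    obtain y z where yz: "f = Upair y z" by (cases f)
    have yz': "y \<frown> z" "y \<noteq> z" using f yz nl by auto
    consider "y = w" | "y = x" | "z = w" | "z = x" | "distinct [w, x, y, z]"
      using wx' yz' by auto
    then show "f \<in> star E e"
    proof cases
      case 5
      have "\<not> (w \<frown> y \<and> x \<frown> z)" "\<not> (w \<frown> z \<and> x \<frown> y)"
        using no[unfolded square_def] 5 wx' yz' adj_sym by (metis distinct_length_2_or_more distinct_singleton)+
      then show ?thesis
        unfolding wx yz using disjoint_in_star[of w x y z] nl wx' yz' 5 by blast
    qed (use incident_in_star[of w x] incident_in_star[of x w] wx yz wx' yz' nl adj_sym in auto)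
  qed
  moreover have "e \<in> vertex_edges E" unfolding wx using vertex_edgeI wx' nl by blast
  ultimately show False using dep independent_if_subset_star by blast
qed

text \<open>
  A square has no chord, since the ends of a chord would have two common neighbours. If \<open>v\<close> were
  adjacent to \<open>a\<close> but not to \<open>c\<close>, the whole square would lie in the star of the edge \<open>v a\<close>.
\<close>

lemma square_neighbours:
  assumes nl: "\<And>x. \<not> looped x" and sq: "square a b c d" and va: "v \<frown> a"
  shows "v \<frown> c"
proof (rule ccontr)
  assume vc: "\<not> v \<frown> c"
  have s: "distinct [a, b, c, d]" "a \<frown> b" "b \<frown> c" "c \<frown> d" "d \<frown> a" using sq by (auto simp: square_def)
  have nac: "\<not> a \<frown> c"
    using common_neighbour_unique[of a c b d] s nl adj_sym by (metis distinct_length_2_or_more)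
  have vv: "v \<noteq> a" "v \<noteq> b" "v \<noteq> c" "v \<noteq> d" using va vc nl s nac adj_sym by metis+
  have "Upair a b \<in> star E (Upair v a)" "Upair d a \<in> star E (Upair v a)"
    using incident_in_star[of a v] va s nl adj_sym by auto
  moreover have "Upair b c \<in> star E (Upair v a)" "Upair c d \<in> star E (Upair v a)"
    using vv s nl vc nac va by (intro disjoint_in_star; auto)+
  ultimately show False
    using independent_no_square[OF star_indep[OF vertex_edgeI[OF va nl]] s(1)] by blast
qed

lemma square_neighbours_eq:
  assumes nl: "\<And>x. \<not> looped x" and sq: "square a b c d"
  shows "v \<frown> a \<longleftrightarrow> v \<frown> c"
  using square_neighbours[OF nl sq] square_neighbours[OF nl square_rotate[OF square_rotate[OF sq]]] by blast

text \<open>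
  A further neighbour \<open>v\<close> of \<open>a\<close> is also one of \<open>c\<close>, and can replace \<open>d\<close> in the square.
\<close>

lemma square_neighbours_eq2:
  assumes nl: "\<And>x. \<not> looped x" and sq: "square a b c d" and va: "v \<frown> a"
  shows "w \<frown> v \<longleftrightarrow> w \<frown> b"
proof (cases "v = b")
  case False
  have s: "distinct [a, b, c, d]" "a \<frown> b" "b \<frown> c" "c \<frown> d" "d \<frown> a" using sq by (auto simp: square_def)
  have vc: "v \<frown> c" using square_neighbours_eq[OF nl sq] va by blast
  have "v \<noteq> a" "v \<noteq> c" using va vc nl by auto
  then have "square a b c v" using s vc va False adj_sym by (auto simp: square_def)
  then show ?thesis using square_neighbours_eq[OF nl square_rotate] by blast
qed simp

text \<open>
  The neighbours of \<open>a\<close> and those of \<open>b\<close> form the parts. An edge avoiding both sets would have no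
  connection to the square at all and contain it in its star.
\<close>

lemma type_alpha_if_loopless:
  assumes nl: "\<And>x. \<not> looped x" and dep: "dependent (edge_point ` E)"
  shows "\<exists>V1 V2. type_alpha E V1 V2"
proof -
  obtain a b c d where sq: "square a b c d" using square_exists[OF nl dep] by blast
  have s: "distinct [a, b, c, d]" "a \<frown> b" "b \<frown> c" "c \<frown> d" "d \<frown> a" using sq by (auto simp: square_def)
  have Na: "w \<frown> v \<longleftrightarrow> w \<frown> b" if "v \<frown> a" for v w
    by (rule square_neighbours_eq2[OF nl sq that])
  have Nc: "w \<frown> c \<longleftrightarrow> w \<frown> a" for w
    using square_neighbours_eq[OF nl sq, of w] by (rule sym)
  have Nd: "w \<frown> d \<longleftrightarrow> w \<frown> b" for w
    using square_neighbours_eq[OF nl square_rotate[OF sq], of w] by (rule sym)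
  have Nb: "w \<frown> v \<longleftrightarrow> w \<frown> a" if "v \<frown> b" for v w
    using square_neighbours_eq2[OF nl square_rotate[OF sq] that, of w] Nc[of w] by simp
  let ?V1 = "{x. x \<frown> b}" and ?V2 = "{x. x \<frown> a}"
  have "\<not> (x \<frown> b \<and> x \<frown> a)" for x using Na[of x x] nl[of x] by blast
  then have disj: "?V1 \<inter> ?V2 = {}" by auto
  have ne: "?V1 \<noteq> {}" "?V2 \<noteq> {}" using s(2) s(5) by auto
  have un: "x \<frown> a \<or> x \<frown> b" for x
  proof (rule ccontr)
    assume "\<not> ?thesis"
    then have z: "\<not> x \<frown> a" "\<not> x \<frown> b" by auto
    obtain w where w: "x \<frown> w" using has_neighbour by blast
    have w': "\<not> w \<frown> a" "\<not> w \<frown> b" using Na[of w x] Nb[of w x] w z by auto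
    have ne: "x \<noteq> a" "x \<noteq> b" "x \<noteq> c" "x \<noteq> d" "w \<noteq> a" "w \<noteq> b" "w \<noteq> c" "w \<noteq> d" "x \<noteq> w"
      using z w' w nl[of x] s adj_sym[OF s(2)] adj_sym[OF s(3)] adj_sym[OF s(4)] adj_sym[OF s(5)] by auto
    have zc: "\<not> x \<frown> c" "\<not> x \<frown> d" "\<not> w \<frown> c" "\<not> w \<frown> d" using z w' Nc Nd by auto
    have "Upair a b \<in> star E (Upair x w)" "Upair b c \<in> star E (Upair x w)"
       "Upair c d \<in> star E (Upair x w)" "Upair d a \<in> star E (Upair x w)"
      using disjoint_in_star[OF w s(2)] disjoint_in_star[OF w s(3)] disjoint_in_star[OF w s(4)]
        disjoint_in_star[OF w s(5)] ne s(1) z zc nl not_sym[of a d] by simp_all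
    then show False
      using independent_no_square[OF star_indep[OF vertex_edgeI[OF w nl]] s(1)] by blast
  qed
  have "E = {Upair i j | i j. i \<in> ?V1 \<and> j \<in> ?V2}"
  proof (intro equalityI subsetI)
    fix e assume e: "e \<in> E"
    obtain x y where xy: "e = Upair x y" by (cases e)
    have yx: "y \<frown> x" using e xy adj_sym by blast
    show "e \<in> {Upair i j | i j. i \<in> ?V1 \<and> j \<in> ?V2}"
    proof (cases "x \<frown> a")
      case True
      then have "y \<frown> b" using Na[OF True] yx by blast
      then show ?thesis using True xy Upair_commute[of x y] by blast
    next
      case False
      then have xb: "x \<frown> b" using un by blast
      then have "y \<frown> a" using Nb[OF xb] yx by blast
      then show ?thesis using xb xy by blast
    qed
  next
    fix e assume "e \<in> {Upair i j | i j. i \<in> ?V1 \<and> j \<in> ?V2}"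
    then obtain x y where "e = Upair x y" "x \<frown> b" "y \<frown> a" by blast
    then show "e \<in> E" using Nb[of x y] adj_sym by blast
  qed
  then have "complete_bipartite E UNIV ?V1 ?V2"
    unfolding complete_bipartite_def using disj ne un by auto
  moreover have "has_4_cycle E" unfolding has_4_cycle_def using s by blast
  ultimately show ?thesis unfolding type_alpha_def by blast
qed

subsection \<open>Graphs with exactly one loop\<close>

text \<open>
  Among the vertices of the polytope, only the edges opposite to the loop in a triangle are missing from
  its star.
\<close>

lemma triangle_at_loop_exists:
  assumes l: "looped l" and ind: "\<not> vertex_edges E \<subseteq> star E (Upair l l)"
  shows "\<exists>j k. distinct [l, j, k] \<and> l \<frown> j \<and> l \<frown> k \<and> Upair j k \<in> vertex_edges E"
proof -
  obtain f where f: "f \<in> vertex_edges E" "f \<notin> star E (Upair l l)" using ind by blast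
  obtain j k where jk: "f = Upair j k" by (cases f)
  have fE: "j \<frown> k" using f(1) vertex_edges_subset jk by blast
  have nS: "Upair j k \<notin> star E (Upair l l)" "Upair k j \<notin> star E (Upair l l)"
    using f(2) by (simp_all add: jk Upair_commute)
  have "j \<noteq> k"
  proof
    assume "j = k"
    then show False using star_loop_loop[OF l, of k] fE nS by simp
  qed
  moreover from this have nlp: "\<not> looped j \<or> \<not> looped k" using f(1) by (simp add: jk vertex_edges_Upair_iff)
  ultimately have adj: "l \<frown> j" "l \<frown> k" using loop_in_star(2)[OF l fE] nS by blast+
  moreover have "l \<noteq> j"
  proof
    assume "l = j"
    then show False using star_loop_incident[of l E k] nS l nlp adj by simp
  qed
  moreover have "l \<noteq> k"
  proof
    assume "l = k"
    then show False using star_loop_incident[of l E j] nS l nlp adj by simp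
  qed
  ultimately show ?thesis using \<open>j \<noteq> k\<close> f(1) jk by auto
qed

context
  fixes l assumes one: "\<And>x. looped x \<longleftrightarrow> x = l"
begin

lemma looped_l: "looped l" by (simp add: one)

lemma not_looped: "x \<noteq> l \<Longrightarrow> \<not> looped x" by (simp add: one)

text \<open>
  Otherwise the star of the edge \<open>v j\<close> contains the looped triangle: its vertex \<open>k\<close> is not adjacent
  to \<open>v\<close> either, because \<open>l\<close> is the only common neighbour of \<open>j\<close> and \<open>k\<close>.
\<close>

lemma neighbour_of_triangle:
  assumes t: "distinct [l, j, k]" "l \<frown> j" "l \<frown> k" "j \<frown> k" and v: "v \<frown> j" "v \<noteq> l"
  shows "v \<frown> l"
proof (rule ccontr)
  assume nvl: "\<not> v \<frown> l"
  have nl: "\<not> looped j" "\<not> looped k" "\<not> looped v" using t(1) v(2) by (auto simp: one)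
  have vk: "v \<noteq> k" "v \<noteq> j" using nvl t v nl adj_sym by blast+
  have nvk: "\<not> v \<frown> k"
    using common_neighbour_unique[of j k l v] t nl v vk adj_sym by auto
  have "Upair l l \<in> star E (Upair v j)"
    using loop_in_star(1)[OF looped_l v(1)] vk nl nvl adj_sym by blast
  moreover have "Upair l j \<in> star E (Upair v j)" "Upair j k \<in> star E (Upair v j)"
    using incident_in_star[of j v l] incident_in_star[of j v k] nl t v adj_sym by auto
  moreover have "Upair l k \<in> star E (Upair v j)"
    using disjoint_in_star[of v j l k] nl t v vk nvk nvl by auto
  ultimately show False
    using independent_no_looped_triangle[OF star_indep[OF vertex_edgeI[OF v(1) nl(3)]] t(1)] by blast
qed

text \<open>
  Otherwise the star of the edge \<open>v l\<close> contains the looped triangle.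
\<close>

lemma loop_neighbour_meets_triangle:
  assumes t: "distinct [l, j, k]" "l \<frown> j" "l \<frown> k" "j \<frown> k" and v: "v \<frown> l" "v \<noteq> l" "v \<noteq> j" "v \<noteq> k"
  shows "v \<frown> j \<or> v \<frown> k"
proof (rule ccontr)
  assume nv: "\<not> (v \<frown> j \<or> v \<frown> k)"
  have nl: "\<not> looped j" "\<not> looped k" "\<not> looped v" using t(1) v(2) by (auto simp: one)
  have ve: "Upair v l \<in> vertex_edges E" by (rule vertex_edgeI[OF v(1) nl(3)])
  have "Upair l l \<in> star E (Upair v l)"
    using own_loop_in_star[OF looped_l adj_sym[OF v(1)] nl(3)] by blast
  moreover have "Upair l j \<in> star E (Upair v l)" "Upair l k \<in> star E (Upair v l)"
    using star_incident_at_loop[of l v E j] star_incident_at_loop[of l v E k] ve nv t v nl looped_l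
      vertex_edgeI'[of l j] vertex_edgeI'[of l k] unfolding Upair_commute[of v l] by auto
  moreover have "Upair j k \<in> star E (Upair v l)"
    using disjoint_in_star[of v l j k] nl t v nv by auto
  ultimately show False
    using independent_no_looped_triangle[OF star_indep[OF ve] t(1)] by blast
qed

text \<open>
  The preceding two lemmas spread the triangle \<open>l, j, k\<close> over the graph: every vertex is adjacent to
  \<open>l\<close>, as an edge at a vertex not adjacent to \<open>l\<close> would have the looped triangle in its star, and
  every other vertex is adjacent to exactly one of \<open>j\<close> and \<open>k\<close>. This defines the parts.
\<close>

lemma type_beta_if_one_loop:
  assumes dep: "dependent (edge_point ` E)"
  shows "\<exists>V1 V2. type_beta E l V1 V2"
proof -
  have VE: "vertex_edges E = E" by (auto simp: vertex_edges_def one)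
  have "\<not> vertex_edges E \<subseteq> star E (Upair l l)"
    using dep independent_if_subset_star[OF vertex_edges_loop[OF looped_l], of E] unfolding VE by blast
  from triangle_at_loop_exists[OF looped_l this]
  obtain j k where t: "distinct [l, j, k]" "l \<frown> j" "l \<frown> k" "j \<frown> k"
    unfolding VE by blast
  have t': "distinct [l, k, j]" "k \<frown> j" using t(1) adj_sym[OF t(4)] by auto
  note meets = loop_neighbour_meets_triangle[OF t]
  note nbr_j = neighbour_of_triangle[OF t] and nbr_k = neighbour_of_triangle[OF t'(1) t(3,2) t'(2)]
  have nl: "\<not> looped x" if "x \<noteq> l" for x using that by (rule not_looped)
  have all: "v \<frown> l" if v: "v \<noteq> l" for v
  proof (rule ccontr)
    assume nvl: "\<not> v \<frown> l"
    obtain u where u: "v \<frown> u" using has_neighbour by blast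
    have "u \<noteq> l" using u nvl by auto
    moreover have "u \<noteq> v" using u nl[OF v] by auto
    ultimately have ul: "u \<noteq> l" "u \<noteq> v" .
    have jk: "\<not> v \<frown> j" "\<not> v \<frown> k"
      using nbr_j[of v] nbr_k[of v] nvl v by auto
    have nul: "\<not> u \<frown> l"
    proof
      assume ul': "u \<frown> l"
      have uj: "u \<noteq> j" "u \<noteq> k" using u jk by auto
      then have "u \<frown> j \<or> u \<frown> k" using meets[OF ul' ul(1)] by blast
      then show False
      proof
        assume "u \<frown> j"
        moreover have "distinct [l, u, j]" using t(1) ul(1) uj by auto
        ultimately show False using neighbour_of_triangle[OF _ adj_sym[OF ul'] t(2) _ u v] nvl by blast
      next
        assume "u \<frown> k"
        moreover have "distinct [l, u, k]" using t(1) ul(1) uj by auto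
        ultimately show False using neighbour_of_triangle[OF _ adj_sym[OF ul'] t(3) _ u v] nvl by blast
      qed
    qed
    have ne: "v \<noteq> j" "v \<noteq> k" "u \<noteq> j" "u \<noteq> k" using nvl nul adj_sym[OF t(2)] adj_sym[OF t(3)] by auto
    have "Upair l l \<in> star E (Upair v u)"
      using loop_in_star(1)[OF looped_l u] ul(2) nl[OF v] nvl adj_sym[of l v] by blast
    moreover have "Upair l j \<in> star E (Upair v u)" "Upair l k \<in> star E (Upair v u)" "Upair j k \<in> star E (Upair v u)"
      using disjoint_in_star[OF u t(2)] disjoint_in_star[OF u t(3)] disjoint_in_star[OF u t(4)]
        t(1) not_sym[of l j] not_sym[of l k] ne v ul nvl nul jk nl[OF v] nl[of j] nl[of k] by simp_all
    ultimately show False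
      using independent_no_looped_triangle[OF star_indep[OF vertex_edgeI[OF u nl[OF v]]] t(1)] by blast
  qed
  let ?V1 = "{x. x \<frown> k \<and> x \<noteq> l}" and ?V2 = "{x. x \<frown> j \<and> x \<noteq> l}"
  have W: "- loops E = - {l}" by (auto simp: one)
  have jkl: "j \<noteq> l" "k \<noteq> l" "j \<noteq> k" using t(1) by auto
  have disj: "?V1 \<inter> ?V2 = {}"
  proof -
    have False if x: "x \<frown> k" "x \<frown> j" "x \<noteq> l" for x
      using common_neighbour_unique[OF t(4) jkl(3) nl[OF jkl(1)] nl[OF jkl(2)] adj_sym[OF x(2)] adj_sym[OF x(1)]
        adj_sym[OF t(2)] adj_sym[OF t(3)]] x(3) by contradiction
    then show ?thesis by auto
  qed
  have "x \<frown> k \<or> x \<frown> j" if "x \<noteq> l" for x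
    using meets[OF all[OF that] that] t(4) t'(2) by blast
  then have un: "?V1 \<union> ?V2 = - {l}" by auto
  have nonadj: "\<not> x \<frown> y" if x: "x \<frown> z" "x \<noteq> l" and y: "y \<frown> z" "y \<noteq> l" and z: "z \<noteq> l" for x y z
  proof
    assume xy: "x \<frown> y"
    then have "x \<noteq> y" using nl[OF x(2)] by auto
    then show False
      using common_neighbour_unique[OF xy _ nl[OF x(2)] nl[OF y(2)] x(1) y(1) all[OF x(2)] all[OF y(2)]] z by blast
  qed
  have nonadj1: "\<not> x \<frown> y" if "x \<in> ?V1" "y \<in> ?V1" for x y
    using nonadj[of x k y] that jkl(2) by blast
  have nonadj2: "\<not> x \<frown> y" if "x \<in> ?V2" "y \<in> ?V2" for x y
    using nonadj[of x j y] that jkl(1) by blast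
  have adj12: "x \<frown> y" if x: "x \<in> ?V1" and y: "y \<in> ?V2" for x y
  proof (cases "y = k")
    case False
    have yx: "y \<noteq> x" "\<not> y \<frown> k" using disj x y by auto
    have x': "x \<frown> k" "x \<noteq> l" and y': "y \<noteq> l" using x y by auto
    have "x \<noteq> k" using x'(1) nl[OF jkl(2)] by auto
    then have d: "distinct [l, x, k]" using x'(2) jkl(2) by auto
    have "y \<frown> x"
      using loop_neighbour_meets_triangle[OF d adj_sym[OF all[OF x'(2)]] t(3) x'(1) all[OF y'] y' yx(1) False] yx(2) by blast
    then show ?thesis by (rule adj_sym)
  qed (use x in auto)
  have "induced E (- loops E) = {Upair i j | i j. i \<in> ?V1 \<and> j \<in> ?V2}"
  proof (intro equalityI subsetI)
    fix e assume e: "e \<in> induced E (- loops E)"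
    obtain x y where xy: "e = Upair x y" by (cases e)
    have "x \<frown> y" "set_uprod (Upair x y) \<subseteq> - {l}" using e unfolding W xy induced_def by blast+
    then have xy': "x \<frown> y" "x \<noteq> l" "y \<noteq> l" by auto
    show "e \<in> {Upair i j | i j. i \<in> ?V1 \<and> j \<in> ?V2}"
    proof (cases "x \<in> ?V1")
      case True
      then have "y \<notin> ?V1" using nonadj1[OF True] xy'(1) by blast
      then have "y \<in> ?V2" using un xy'(3) by blast
      then show ?thesis using True unfolding xy by blast
    next
      case False
      then have x2: "x \<in> ?V2" using un xy'(2) by blast
      then have "y \<notin> ?V2" using nonadj2[OF x2] xy'(1) by blast
      then have "y \<in> ?V1" using un xy'(3) by blast
      then show ?thesis using x2 unfolding xy Upair_commute[of x y] by blast
    qed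
  next
    fix e assume "e \<in> {Upair i j | i j. i \<in> ?V1 \<and> j \<in> ?V2}"
    then obtain x y where e: "e = Upair x y" "x \<in> ?V1" "y \<in> ?V2" by blast
    have "x \<frown> y" using adj12[OF e(2,3)] .
    then show "e \<in> induced E (- loops E)" using e unfolding W induced_def by simp blast
  qed
  moreover have "?V1 \<noteq> {}" "?V2 \<noteq> {}" using t(4) t'(2) jkl by auto
  ultimately have "complete_bipartite (induced E (- loops E)) (- loops E) ?V1 ?V2"
    unfolding complete_bipartite_def W using disj un by blast
  moreover have "loops E = {l}" by (auto simp: one)
  moreover have "\<forall>w \<in> - loops E. l \<frown> w"
    unfolding W using adj_sym[OF all] by blast
  ultimately show ?thesis unfolding type_beta_def by blast
qed

end

subsection \<open>Graphs with at least two loops\<close>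

context
  fixes p q assumes two: "looped p" "looped q" "p \<noteq> q"
begin

text \<open>
  Compare the triangle \<open>i, j, k\<close> with a second loop \<open>l\<close>. If \<open>l\<close> is adjacent to both \<open>j\<close> and \<open>k\<close>,
  these have two common neighbours; if it is adjacent to one of them, the star of \<open>j k\<close> contains
  the triangle together with \<open>l\<close> and the connecting edge; if to none, the star of \<open>l\<close> contains the
  triangle and its loop.
\<close>

lemma no_triangle_at_loop:
  assumes "looped i" "\<not> looped j" "\<not> looped k" "j \<noteq> k" "j \<frown> k" "i \<frown> j" "i \<frown> k"
  shows False
proof -
  obtain l where l: "looped l" "l \<noteq> i"
  proof (cases "i = p")
    case True
    then show thesis using that[OF two(2)] two(3) by blast
  next
    case False
    then show thesis using that[OF two(1)] by blast
  qed
  have "j \<noteq> i" "k \<noteq> i" "j \<noteq> l" "k \<noteq> l" using assms(1-3) l(1) by auto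
  then have d: "distinct [l, i, j, k]" and ne: "i \<noteq> j" "i \<noteq> k" using assms(4) l(2) by auto
  have kj: "k \<frown> j" and ji: "j \<frown> i" and ki: "k \<frown> i" using assms adj_sym by blast+
  have ind: "independent (edge_point ` star E (Upair j k))" by (rule star_indep[OF vertex_edgeI[OF assms(5,2)]])
  have st: "Upair i j \<in> star E (Upair j k)" "Upair i k \<in> star E (Upair j k)"
    using incident_in_star(2)[OF assms(5) ji assms(2)] incident_in_star(4)[OF kj ki assms(3)] .
  consider "l \<frown> j" "l \<frown> k" | "l \<frown> j" "\<not> l \<frown> k" | "\<not> l \<frown> j" "l \<frown> k" | "\<not> l \<frown> j" "\<not> l \<frown> k" by blast
  then show False
  proof cases
    case 1
    show ?thesis
      using common_neighbour_unique[OF assms(5,4,2,3) ji ki adj_sym[OF 1(1)] adj_sym[OF 1(2)]] l(2) by blast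
  next
    case 2
    have "Upair l l \<in> star E (Upair j k)"
      using loop_in_star(1)[OF l(1) assms(5,4)] assms(2) 2(2) by blast
    moreover have "Upair l j \<in> star E (Upair j k)"
      by (rule incident_in_star(2)[OF assms(5) adj_sym[OF 2(1)] assms(2)])
    ultimately show ?thesis
      using independent_no_loop_edge_triangle[OF ind d] st self_in_star by blast
  next
    case 3
    have "Upair l l \<in> star E (Upair j k)"
      using loop_in_star(1)[OF l(1) assms(5,4)] assms(2) 3(1) by blast
    moreover have "Upair l k \<in> star E (Upair j k)"
      by (rule incident_in_star(4)[OF kj adj_sym[OF 3(2)] assms(3)])
    moreover have "Upair k j \<in> star E (Upair j k)"
      using self_in_star[of "Upair j k"] unfolding Upair_commute[of k j] .
    moreover have "distinct [l, i, k, j]" using d by auto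
    ultimately show ?thesis
      using independent_no_loop_edge_triangle[OF ind, of l i k j] st by blast
  next
    case 4
    have "Upair i i \<in> star E (Upair l l)" by (rule star_loop_loop[OF l(1) assms(1)])
    moreover have "Upair i j \<in> star E (Upair l l)"
      using loop_in_star(2)[OF l(1) assms(6) ne(1)] assms(2) 4(1) by blast
    moreover have "Upair i k \<in> star E (Upair l l)"
      using loop_in_star(2)[OF l(1) assms(7) ne(2)] assms(3) 4(2) by blast
    moreover have "Upair j k \<in> star E (Upair l l)"
      using loop_in_star(2)[OF l(1) assms(5,4)] assms(2) 4(1) by blast
    moreover have "distinct [i, j, k]" using d by simp
    ultimately show ?thesis
      using independent_no_looped_triangle[OF star_indep[OF vertex_edges_loop[OF l(1)]]] by blast
  qed
qed

text \<open>
  Otherwise the star of the loop at \<open>l\<close> contains the loops at \<open>i\<close> and \<open>k\<close> and the path joining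
  them through \<open>j\<close>.
\<close>

lemma adjacent_to_two_loops:
  assumes "\<not> looped j" "looped i" "looped k" "i \<noteq> k" "i \<frown> j" "k \<frown> j" "looped l"
  shows "l \<frown> j"
proof (rule ccontr)
  assume n: "\<not> l \<frown> j"
  have ne: "j \<noteq> i" "j \<noteq> k" using assms(1-3) by auto
  have d: "distinct [i, k, j]" using assms(4) ne by simp
  have "Upair i i \<in> star E (Upair l l)" "Upair k k \<in> star E (Upair l l)"
    using star_loop_loop[OF assms(7) assms(2)] star_loop_loop[OF assms(7) assms(3)] .
  moreover have "Upair j i \<in> star E (Upair l l)" "Upair j k \<in> star E (Upair l l)"
    using loop_in_star(2)[OF assms(7) adj_sym[OF assms(5)] ne(1) disjI1[OF assms(1)] disjI1[OF n]]
      loop_in_star(2)[OF assms(7) adj_sym[OF assms(6)] ne(2) disjI1[OF assms(1)] disjI1[OF n]] .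
  ultimately show False
    using independent_no_path_between_loops[OF star_indep[OF vertex_edges_loop[OF assms(7)]] d] by blast
qed

text \<open>
  If \<open>w\<close> is adjacent to a looped vertex \<open>x\<close> but not to \<open>y\<close>, the star of \<open>w x\<close> contains the loops
  at \<open>x\<close> and \<open>y\<close> and the path through \<open>j\<close> joining them. If \<open>w\<close> has no looped neighbour, the star of
  any edge at \<open>w\<close> contains the loops at \<open>p\<close> and \<open>q\<close> and the path through \<open>j\<close>.
\<close>

lemma adjacent_to_all_loops:
  assumes j: "\<not> looped j" "\<And>x. looped x \<Longrightarrow> x \<frown> j" and w: "\<not> looped w" and y: "looped y"
  shows "y \<frown> w"
proof (cases "\<exists>x. looped x \<and> x \<frown> w")
  case True
  then obtain x where x: "looped x" "x \<frown> w" by blast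
  show ?thesis
  proof (rule ccontr)
    assume n: "\<not> y \<frown> w"
    have ne: "x \<noteq> y" "w \<noteq> j" using x n j y by auto
    have d: "distinct [x, y, j]" using ne x y j by auto
    have xj: "x \<frown> j" and yj: "y \<frown> j" and wx: "w \<frown> x" using j(2) x y adj_sym by blast+
    have nwj: "\<not> w \<frown> j" using no_triangle_at_loop[OF x(1) w j(1) ne(2) _ x(2) xj] by blast
    have ve: "Upair w x \<in> vertex_edges E" using vertex_edgeI[OF wx w] .
    have "Upair x x \<in> star E (Upair w x)" using own_loop_in_star(2)[OF x w] .
    moreover have "Upair j x \<in> star E (Upair w x)"
    proof -
      have "Upair x j \<in> star E (Upair x w)"
        using star_incident_at_loop[OF vertex_edgeI'[OF x(2) w] vertex_edgeI'[OF xj j(1)] _ _ x(1) nwj] x w j by blast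
      then show ?thesis unfolding Upair_commute[of x] .
    qed
    moreover have "Upair y y \<in> star E (Upair w x)"
      using loop_in_star(1)[OF y wx] x(1) w n by blast
    moreover have "Upair j y \<in> star E (Upair w x)"
      using disjoint_in_star[OF wx adj_sym[OF yj]] w y j(1) nwj n ne d x(1) Upair_commute[of w y] by auto
    ultimately show False using independent_no_path_between_loops[OF star_indep[OF ve] d] by blast
  qed
next
  case False
  have d: "distinct [p, q, j]" using two j by auto
  obtain u where u: "w \<frown> u" using has_neighbour by blast
  have ve: "Upair w x \<in> vertex_edges E" if "w \<frown> x" for x using vertex_edgeI[OF that w] .
  have nL: "\<not> x \<frown> w" "\<not> w \<frown> x" if "looped x" for x using False that adj_sym by blast+
  have loop: "Upair x x \<in> star E (Upair w z)" if "looped x" "w \<frown> z" for x z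
  proof -
    have "w \<noteq> z" using that(2) w by auto
    then show ?thesis using loop_in_star(1)[OF that] w nL[OF that(1)] by blast
  qed
  have nwj: "\<not> w \<frown> j"
  proof
    assume wj: "w \<frown> j"
    have "Upair j p \<in> star E (Upair w j)" "Upair j q \<in> star E (Upair w j)"
      using incident_in_star(3)[OF adj_sym[OF wj] adj_sym[OF j(2)] j(1)] two by blast+
    then show False
      using independent_no_path_between_loops[OF star_indep[OF ve[OF wj]] d] loop[OF _ wj] two by blast
  qed
  have ne: "u \<noteq> j" "\<not> looped u" using u nwj nL(2) by auto
  have ne': "u \<noteq> w" "w \<noteq> j" using u w nL(1)[OF two(1)] j(2)[OF two(1)] by auto
  have "Upair j x \<in> star E (Upair w u)" if x: "looped x" for x
  proof -
    have "distinct [w, u, j, x]" using ne ne' x w j(1) by auto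
    then show ?thesis
      using disjoint_in_star[OF u adj_sym[OF j(2)[OF x]]] w ne(2) nwj nL[OF x] j(1) by blast
  qed
  then show ?thesis
    using independent_no_path_between_loops[OF star_indep[OF ve[OF u]] d] loop[OF _ u] two by blast
qed

lemma type_gamma_if_dependent:
  assumes dep: "dependent (edge_point ` vertex_edges E)"
  shows "type_gamma E"
proof -
  have "\<not> vertex_edges E \<subseteq> star E (Upair p p)"
    using dep independent_if_subset_star[OF vertex_edges_loop[OF two(1)]] by blast
  then obtain j k where t: "distinct [p, j, k]" "p \<frown> j" "p \<frown> k" "Upair j k \<in> vertex_edges E"
    using triangle_at_loop_exists[OF two(1)] by blast
  have jk: "j \<frown> k" using t(4) vertex_edges_subset by blast
  have "\<exists>x. \<not> looped x \<and> (\<forall>y. looped y \<longrightarrow> y \<frown> x)"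
  proof -
    have "\<not> looped j \<or> \<not> looped k" using t by (auto simp: vertex_edges_Upair_iff)
    moreover have "looped j \<or> looped k" using no_triangle_at_loop[OF two(1), of j k] t jk by auto
    ultimately consider "\<not> looped j" "looped k" | "looped j" "\<not> looped k" by blast
    then show ?thesis
    proof cases
      case 1
      then have "y \<frown> j" if "looped y" for y
        using adjacent_to_two_loops[OF 1(1) two(1) 1(2) _ t(2) adj_sym[OF jk] that] t(1) by auto
      then show ?thesis using 1 by blast
    next
      case 2
      then have "y \<frown> k" if "looped y" for y
        using adjacent_to_two_loops[OF 2(2) two(1) 2(1) _ t(3) jk that] t(1) by auto
      then show ?thesis using 2 by blast
    qed
  qed
  then obtain x where x: "\<not> looped x" "\<And>y. looped y \<Longrightarrow> y \<frown> x" by blast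
  have all: "y \<frown> w" if "looped y" "\<not> looped w" for y w using adjacent_to_all_loops[OF x that(2,1)] .
  have "{p, q} \<subseteq> loops E" using two by auto
  then have "card {p, q} \<le> card (loops E)" by (intro card_mono) auto
  then have "card (loops E) \<ge> 2" using two by simp
  moreover have "- loops E \<noteq> {}" using x by auto
  moreover have "induced E (- loops E) = {}"
  proof (rule ccontr)
    assume "induced E (- loops E) \<noteq> {}"
    then obtain e where e: "e \<in> E" "set_uprod e \<subseteq> - loops E" by (auto simp: induced_def)
    obtain y z where yz: "e = Upair y z" by (cases e)
    have "y \<frown> z" "\<not> looped y" "\<not> looped z" using e yz by auto
    moreover from this have "y \<noteq> z" by auto
    ultimately show False using no_triangle_at_loop[OF two(1), of y z] all two(1) by blast
  qed
  moreover have "\<forall>v \<in> loops E. \<forall>w \<in> - loops E. v \<frown> w" using all by auto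
  ultimately show ?thesis unfolding type_gamma_def by blast
qed

lemma type_simplex_if_independent:
  assumes ind: "independent (edge_point ` vertex_edges E)"
  shows "type_simplex E"
proof -
  let ?S = "edge_point ` vertex_edges E"
  have "edge_point e \<in> convex hull ?S" if e: "e \<in> E" for e
  proof (cases "e \<in> vertex_edges E")
    case False
    then obtain i j where ij: "e = Upair i j" "looped i" "looped j" using e by (auto simp: vertex_edges_def)
    then have "edge_point (Upair i i) \<in> convex hull ?S" "edge_point (Upair j j) \<in> convex hull ?S"
      by (auto intro!: hull_inc imageI vertex_edges_loop simp del: edge_point_Upair)
    moreover have "edge_point e = midpoint (edge_point (Upair i i)) (edge_point (Upair j j))"
      by (simp add: ij(1) midpoint_def vec_eq_iff)
    ultimately show ?thesis
      using convex_contains_segment[of "convex hull ?S"] midpoint_in_closed_segment by (metis convex_convex_hull subsetD)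
  qed (auto intro: hull_inc)
  then have "edge_polytope E \<subseteq> convex hull ?S"
    unfolding edge_polytope_def by (intro hull_minimal) auto
  moreover have "convex hull ?S \<subseteq> edge_polytope E"
    unfolding edge_polytope_def using vertex_edges_subset by (intro hull_mono image_mono)
  ultimately have "edge_polytope E = convex hull ?S" by blast
  moreover have "\<not> affine_dependent ?S" using ind affine_dependent_imp_dependent by blast
  ultimately have "(int (card ?S) - 1) simplex edge_polytope E"
    unfolding simplex_def by (intro exI[of _ ?S]) auto
  moreover have "{p, q} \<subseteq> loops E" using two by auto
  then have "card {p, q} \<le> card (loops E)" by (intro card_mono) auto
  then have "card (loops E) \<ge> 2" using two by simp
  ultimately show ?thesis unfolding type_simplex_def by blast
qed

end

theorem classification:
  assumes dep: "dependent (edge_point ` E)"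
  shows "(\<exists>V1 V2. type_alpha E V1 V2) \<or> (\<exists>v V1 V2. type_beta E v V1 V2) \<or> type_gamma E \<or>
    (type_simplex E \<and> independent (edge_point ` vertex_edges E))"
proof -
  consider "\<And>x. \<not> looped x" | l where "\<And>x. looped x \<longleftrightarrow> x = l" | p q where "looped p" "looped q" "p \<noteq> q"
    by metis
  then show ?thesis
  proof cases
    case 1
    then show ?thesis using type_alpha_if_loopless dep by blast
  next
    case 2
    then show ?thesis using type_beta_if_one_loop[OF 2 dep] by blast
  next
    case 3
    then show ?thesis using type_gamma_if_dependent[OF 3] type_simplex_if_independent[OF 3] by blast
  qed
qed

end

section \<open>Weights on the fibres of an edge ring\<close>

lift_definition edge_degree :: "'v uprod \<Rightarrow> 'v monomial" is
  "\<lambda>(i, j). Poly_Mapping.single i 1 + Poly_Mapping.single j 1"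
  by (auto simp: add.commute)

lemma edge_degree_Upair: "edge_degree (Upair i j) = Poly_Mapping.single i 1 + Poly_Mapping.single j 1"
  by transfer simp

lemma edge_monomial_eq: "(edge_monomial :: _ \<Rightarrow> ('v, 'k::field) mpoly) = (\<lambda>e. monom (edge_degree e))"
proof
  fix e :: "'v uprod"
  show "(edge_monomial e :: ('v, 'k) mpoly) = monom (edge_degree e)"
  proof (cases e)
    case (Upair i j)
    have "(edge_monomial (Upair i j) :: ('v, 'k) mpoly) = var i * var j" by transfer simp
    then show ?thesis by (simp add: Upair var_def monom_mult edge_degree_Upair)
  qed
qed

lemma edge_degree_swap:
  "edge_degree (Upair i j) + edge_degree (Upair k l) = edge_degree (Upair i l) + edge_degree (Upair k j)"
  by (simp add: edge_degree_Upair ac_simps)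

lemma weight_edge_degree:
  "weight w e = (\<Sum>i\<in>UNIV. w i * real (lookup (edge_degree e) i))"
proof (cases e)
  case (Upair j k)
  have "(\<Sum>i\<in>UNIV. w i * real (lookup (edge_degree (Upair j k)) i)) =
     (\<Sum>i\<in>UNIV. (if i = j then w i else 0) + (if i = k then w i else 0))"
    by (intro sum.cong) (auto simp: edge_degree_Upair lookup_add lookup_single when_def distrib_left)
  then show ?thesis by (simp add: Upair sum.distrib)
qed

lemma sum_weight_image_monomial:
  "(\<Sum>e\<in>keys u. real (lookup u e) * weight w e) =
    (\<Sum>i\<in>UNIV. w i * real (lookup (image_monomial edge_degree u) i))"
proof -
  have "(\<Sum>i\<in>UNIV. w i * real (lookup (image_monomial edge_degree u) i)) =
      (\<Sum>i\<in>UNIV. \<Sum>e\<in>keys u. real (lookup u e) * (w i * real (lookup (edge_degree e) i)))"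
    by (simp add: lookup_image_monomial sum_distrib_left ac_simps)
  also have "\<dots> = (\<Sum>e\<in>keys u. \<Sum>i\<in>UNIV. real (lookup u e) * (w i * real (lookup (edge_degree e) i)))"
    by (rule sum.swap)
  finally show ?thesis by (simp add: weight_edge_degree sum_distrib_left)
qed

lemma image_monomial_edge_degree_homogeneous:
  fixes u v :: "('v::finite uprod) monomial"
  assumes "image_monomial edge_degree u = image_monomial edge_degree v"
  shows "monomial_degree u = monomial_degree v"
proof -
  have w: "weight (\<lambda>_. 1) e = 2" for e :: "'v uprod"
    by (cases e) simp
  have "real (monomial_degree t) * 2 = (\<Sum>e\<in>keys t. real (lookup t e) * weight (\<lambda>_. 1) e)"
    for t :: "('v uprod) monomial"
    by (simp add: monomial_degree_def w sum_distrib_right)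
  then have "real (monomial_degree u) * 2 = real (monomial_degree v) * 2"
    by (simp only: sum_weight_image_monomial assms)
  then show ?thesis by simp
qed

lemma exists_positive_weight:
  assumes eq: "image_monomial edge_degree u = image_monomial edge_degree v"
    and nonneg: "\<And>f. f \<in> keys u \<Longrightarrow> weight w f \<ge> 0" and e: "e \<in> keys u" "weight w e > 0"
  shows "\<exists>f\<in>keys v. weight w f > 0"
proof (rule ccontr)
  assume n: "\<not> ?thesis"
  have "0 < (\<Sum>e\<in>keys u. real (lookup u e) * weight w e)"
    by (rule sum_pos2[of _ e]) (use nonneg e in \<open>auto simp: in_keys_iff\<close>)
  also have "\<dots> = (\<Sum>e\<in>keys v. real (lookup v e) * weight w e)"
    by (simp only: sum_weight_image_monomial eq)
  also have "\<dots> \<le> 0"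
    by (rule sum_nonpos) (use n in \<open>auto simp: mult_le_0_iff not_less\<close>)
  finally show False by simp
qed

text \<open>
  The degree of \<open>i\<close> is the same for both monomials.
\<close>

lemma exists_incident:
  fixes u v :: "('v::finite uprod) monomial"
  assumes eq: "image_monomial edge_degree u = image_monomial edge_degree v"
    and e: "Upair i j \<in> keys u"
  shows "\<exists>k. Upair i k \<in> keys v"
proof -
  let ?w = "\<lambda>x. if x = i then 1 else 0 :: real"
  have "weight ?w f \<ge> 0" for f by (cases f) simp
  moreover have "weight ?w (Upair i j) > 0" by simp
  ultimately obtain f where f: "f \<in> keys v" "weight ?w f > 0"
    using exists_positive_weight[OF eq _ e, of ?w] by blast
  obtain x y where xy: "f = Upair x y" by (cases f)
  then have "x = i \<or> y = i" using f(2) by (auto split: if_splits)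
  then show ?thesis
  proof
    assume "x = i" then show ?thesis using f(1) xy by blast
  next
    assume "y = i" then show ?thesis using f(1) xy unfolding Upair_commute[of x y] by blast
  qed
qed

text \<open>
  The difference of two monomials of a fibre is a linear relation between edge vectors.
\<close>

lemma relation_in_span:
  fixes E :: "'v::finite uprod set"
  assumes eq: "image_monomial edge_degree u = image_monomial edge_degree v"
    and "keys u \<subseteq> E" "keys v \<subseteq> E" and ne: "lookup u g \<noteq> lookup v g"
  shows "edge_point g \<in> span (edge_point ` (E - {g}))"
proof -
  define c where "c e = real (lookup u e) - real (lookup v e)" for e
  have "g \<in> keys u \<or> g \<in> keys v" using ne by (auto simp: in_keys_iff)
  then have g: "g \<in> E" using assms(2,3) by blast
  have sum: "(\<Sum>e\<in>E. real (lookup t e) * weight w e) =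
      (\<Sum>i\<in>UNIV. w i * real (lookup (image_monomial edge_degree t) i))" if "keys t \<subseteq> E" for t w
    unfolding sum_weight_image_monomial[symmetric]
    by (rule sum.mono_neutral_right) (use that in \<open>auto simp: in_keys_iff\<close>)
  have "(\<Sum>e\<in>E. c e *\<^sub>R edge_point e) = 0"
  proof (rule vec_eq_iff[THEN iffD2], rule allI)
    fix i :: 'v
    have comp: "edge_point e $ i = weight (\<lambda>x. if x = i then 1 else 0) e" for e :: "'v uprod"
      by (cases e) (auto simp: axis_def)
    have "(\<Sum>e\<in>E. c e *\<^sub>R edge_point e) $ i = (\<Sum>e\<in>E. c e * weight (\<lambda>x. if x = i then 1 else 0) e)"
      by (simp add: comp)
    also have "\<dots> = 0" using sum[OF assms(2)] sum[OF assms(3)] eq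
      by (simp add: c_def left_diff_distrib sum_subtractf)
    finally show "(\<Sum>e\<in>E. c e *\<^sub>R edge_point e) $ i = 0 $ i" by simp
  qed
  then have "c g *\<^sub>R edge_point g + (\<Sum>e\<in>E - {g}. c e *\<^sub>R edge_point e) = 0"
    using g by (simp add: sum.remove)
  then have "c g *\<^sub>R edge_point g = - (\<Sum>e\<in>E - {g}. c e *\<^sub>R edge_point e)"
    by (simp add: eq_neg_iff_add_eq_0)
  moreover have "(\<Sum>e\<in>E - {g}. c e *\<^sub>R edge_point e) \<in> span (edge_point ` (E - {g}))"
    by (intro span_sum span_scale span_base) auto
  ultimately have "c g *\<^sub>R edge_point g \<in> span (edge_point ` (E - {g}))"
    by (simp add: span_neg)
  then have "(1 / c g) *\<^sub>R c g *\<^sub>R edge_point g \<in> span (edge_point ` (E - {g}))" by (rule span_scale)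
  moreover have "c g \<noteq> 0" using ne by (simp add: c_def)
  ultimately show ?thesis by simp
qed

lemma toric_ideal_nonzero_dependent:
  fixes E :: "'v::finite uprod set"
  assumes "(toric_ideal E :: ('v uprod, 'k::field) mpoly set) \<noteq> {0}"
  shows "dependent (edge_point ` E)"
proof -
  have "(0 :: ('v uprod, 'k) mpoly) \<in> toric_ideal E"
    by (simp add: toric_ideal_def poly_ring_zero eval_hom_def)
  then obtain p :: "('v uprod, 'k) mpoly" where p: "p \<in> toric_ideal E" "p \<noteq> 0"
    using assms by blast
  have "keys p \<noteq> {}" using p(2) by simp
  then obtain u where u: "u \<in> keys p" by blast
  have p': "p \<in> poly_ring E" "eval_hom (\<lambda>e. monom (edge_degree e)) p = 0"
    using p(1) by (simp_all add: toric_ideal_def edge_monomial_eq)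
  obtain v where v: "v \<in> keys p" "v \<noteq> u" "image_monomial edge_degree v = image_monomial edge_degree u"
    using fibre_partner[OF p'(2) u] by blast
  have sub: "keys u \<subseteq> E" "keys v \<subseteq> E" using p'(1) u v(1) by (simp_all add: poly_ring_def)
  obtain g where g: "lookup v g \<noteq> lookup u g" using v(2) poly_mapping_eqI[of v u] by blast
  then have "g \<in> keys u \<or> g \<in> keys v" by (auto simp: in_keys_iff)
  then have gE: "g \<in> E" using sub by blast
  have "edge_point g \<in> span (edge_point ` (E - {g}))" by (rule relation_in_span[OF v(3) sub(2,1) g])
  then show ?thesis using independent_no_relation[of E g "E - {g}"] gE by blast
qed

section \<open>Quadratic reductions for the four types\<close>

locale ordered_edges = lex_order E r for E :: "'v::finite uprod set" and r +
  fixes lab :: "'v \<Rightarrow> nat"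
  assumes adm: "admissible_var_order E lab r" and inj: "inj lab"
begin

lemma edge_less_iff:
  "Upair i j \<in> E \<Longrightarrow> Upair k l \<in> E \<Longrightarrow> lab i < lab j \<Longrightarrow> lab k < lab l \<Longrightarrow>
   (Upair i j, Upair k l) \<in> r \<longleftrightarrow> lab i < lab k \<or> lab i = lab k \<and> lab j > lab l"
  using adm[unfolded admissible_var_order_def, THEN conjunct2, THEN conjunct2, rule_format, of i j k l] by blast

lemma edge_less_loop:
  assumes "Upair i i \<in> E" "Upair k l \<in> E" "k \<noteq> l"
  shows "(Upair k l, Upair i i) \<in> r"
proof -
  have *: "(Upair x y, Upair i i) \<in> r" if "Upair x y \<in> E" "lab x < lab y" for x y
    using adm[unfolded admissible_var_order_def, THEN conjunct2, THEN conjunct1, rule_format, of i x y] assms(1) that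
    by blast
  have "lab k \<noteq> lab l" using inj_eq[OF inj] assms(3) by simp
  then consider "lab k < lab l" | "lab l < lab k" by linarith
  then show ?thesis
  proof cases
    case 1 then show ?thesis using * assms(2) by blast
  next
    case 2 then show ?thesis using *[of l k] assms(2) unfolding Upair_commute[of l k] by blast
  qed
qed

definition reduces :: "'v uprod monomial \<Rightarrow> 'v uprod \<Rightarrow> bool" where
  "reduces u e \<longleftrightarrow> (\<exists>f e' f'. f \<in> keys u \<and> f \<noteq> e \<and> e' \<in> E \<and> f' \<in> E \<and> (e', e) \<in> r \<and> (f', e) \<in> r \<and>
     edge_degree e + edge_degree f = edge_degree e' + edge_degree f')"

lemma reducesI:
  assumes "e = Upair i j" "Upair k l \<in> keys u" "Upair k l \<noteq> e" "Upair i l \<in> E" "Upair k j \<in> E"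
    "(Upair i l, e) \<in> r" "(Upair k j, e) \<in> r"
  shows "reduces u e"
proof -
  have "edge_degree e + edge_degree (Upair k l) = edge_degree (Upair i l) + edge_degree (Upair k j)"
    unfolding assms(1) by (rule edge_degree_swap)
  then show ?thesis
    unfolding reduces_def
    by (intro exI[of _ "Upair k l"] exI[of _ "Upair i l"] exI[of _ "Upair k j"] conjI assms(2-7))
qed

text \<open>
  The situation of the reduction hypothesis: disjoint monomials of one fibre whose greatest variable
  \<open>e\<close> occurs in \<open>u\<close>.
\<close>

definition led_by :: "'v uprod monomial \<Rightarrow> 'v uprod monomial \<Rightarrow> 'v uprod \<Rightarrow> bool" where
  "led_by u v e \<longleftrightarrow> keys u \<subseteq> E \<and> keys v \<subseteq> E \<and> image_monomial edge_degree u = image_monomial edge_degree v \<and>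
     keys u \<inter> keys v = {} \<and> e \<in> keys u \<and> (\<forall>g\<in>keys u \<union> keys v. g \<noteq> e \<longrightarrow> (g, e) \<in> r)"

context
  fixes u v e assumes lead: "led_by u v e"
begin

lemma led_byD:
  "keys u \<subseteq> E" "keys v \<subseteq> E" "image_monomial edge_degree u = image_monomial edge_degree v"
  "image_monomial edge_degree v = image_monomial edge_degree u"
  "e \<in> keys u" "e \<in> E"
proof -
  note l = lead[unfolded led_by_def]
  show 1: "keys u \<subseteq> E" using l by (elim conjE)
  show "keys v \<subseteq> E" using l by (elim conjE)
  show 2: "image_monomial edge_degree u = image_monomial edge_degree v" using l by (elim conjE)
  show "image_monomial edge_degree v = image_monomial edge_degree u" by (rule 2[symmetric])
  show 3: "e \<in> keys u" using l by (elim conjE)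
  show "e \<in> E" using 1 3 by (rule subsetD)
qed

lemma led_by_disjoint: "g \<in> keys u \<Longrightarrow> g \<in> keys v \<Longrightarrow> False"
  using lead unfolding led_by_def by auto

lemma led_by_less: "g \<in> keys u \<union> keys v \<Longrightarrow> g \<noteq> e \<Longrightarrow> (g, e) \<in> r"
proof -
  have "\<forall>g\<in>keys u \<union> keys v. g \<noteq> e \<longrightarrow> (g, e) \<in> r" using lead[unfolded led_by_def] by (elim conjE)
  then show "g \<in> keys u \<union> keys v \<Longrightarrow> g \<noteq> e \<Longrightarrow> (g, e) \<in> r" by blast
qed

lemma led_by_no_loop:
  assumes "e = Upair i j" "i \<noteq> j" "Upair k k \<in> keys u \<union> keys v"
  shows False
proof -
  have "Upair k k \<noteq> e" using assms by auto
  then have "(Upair k k, e) \<in> r" using led_by_less assms(3) by blast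
  moreover have "(e, Upair k k) \<in> r"
    using edge_less_loop[of k i j] led_byD assms by blast
  ultimately show False using r_asym by blast
qed

lemma led_by_edge_cases:
  assumes "e = Upair i j" "lab i < lab j" "Upair k l \<in> keys u \<union> keys v" "lab k < lab l"
  shows "lab k < lab i \<or> k = i \<and> lab j \<le> lab l"
proof (cases "Upair k l = e")
  case True
  then show ?thesis using assms by auto
next
  case False
  then have "(Upair k l, Upair i j) \<in> r" using led_by_less assms by blast
  moreover have "Upair k l \<in> E" "Upair i j \<in> E" using led_byD assms(1,3) by blast+
  ultimately have "lab k < lab i \<or> lab k = lab i \<and> lab l > lab j" using edge_less_iff assms(2,4) by blast
  then show ?thesis using inj_eq[OF inj] by auto
qed

text \<open>
  Give \<open>i\<close> the weight \<open>1\<close> and the other vertices \<open>- 1\<close>. Only the loop at \<open>i\<close> has positive weight,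
  and it does not occur in \<open>v\<close>; so \<open>u\<close> contains an edge of negative weight, that is, one avoiding
  \<open>i\<close>, and together with the loop this can be exchanged for two edges at \<open>i\<close>.
\<close>

lemma reduces_loop:
  assumes e: "e = Upair i i"
    and adj: "\<And>j k. Upair j k \<in> keys u \<Longrightarrow> j \<noteq> i \<Longrightarrow> k \<noteq> i \<Longrightarrow> Upair i j \<in> E"
  shows "reduces u e"
proof -
  have "\<exists>j k. Upair j k \<in> keys u \<and> j \<noteq> i \<and> k \<noteq> i"
  proof (rule ccontr)
    assume n: "\<nexists>j k. Upair j k \<in> keys u \<and> j \<noteq> i \<and> k \<noteq> i"
    let ?w = "\<lambda>x. if x = i then 1 else - 1 :: real"
    have "weight ?w f \<ge> 0" if "f \<in> keys u" for f
      using n that by (cases f) auto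
    moreover have "weight ?w e > 0" by (simp add: e)
    ultimately obtain f where f: "f \<in> keys v" "weight ?w f > 0"
      using exists_positive_weight[OF led_byD(3) _ led_byD(5), of ?w] by blast
    then have "f = e" unfolding e by (cases f) (auto split: if_splits)
    then show False using f(1) led_byD(5) led_by_disjoint by blast
  qed
  then obtain j k where jk: "Upair j k \<in> keys u" "j \<noteq> i" "k \<noteq> i" by blast
  have kj: "Upair k j \<in> keys u" using jk(1) by (simp add: Upair_commute)
  have E: "Upair i k \<in> E" "Upair i j \<in> E" "Upair i i \<in> E"
    using adj[OF jk] adj[OF kj jk(3,2)] led_byD(6) e by blast+
  have E': "Upair j i \<in> E" using E(2) by (simp add: Upair_commute)
  show ?thesis
    by (rule reducesI[OF e jk(1)])
      (use jk E E' edge_less_loop in \<open>auto simp: e\<close>)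
qed

text \<open>
  Think of the edges between \<open>R\<close> and \<open>C\<close> as the entries of a matrix. The entry of \<open>v\<close> in the
  row of \<open>e\<close> lies in a later column, whose degree is attained in \<open>u\<close> by an entry \<open>f\<close> of an
  earlier row. The other two corners of the rectangle spanned by \<open>e\<close> and \<open>f\<close> are smaller than \<open>e\<close>.
\<close>

lemma reduces_matrix:
  assumes e: "e = Upair k j" "k \<in> R" "j \<in> C"
    and adj: "\<And>x y. x \<in> R \<Longrightarrow> y \<in> C \<Longrightarrow> Upair x y \<in> E" and lt: "\<And>x y. x \<in> R \<Longrightarrow> y \<in> C \<Longrightarrow> lab x < lab y"
    and kl: "Upair k l \<in> keys v" "l \<in> C" and col: "\<And>x. Upair l x \<in> keys u \<Longrightarrow> x \<in> R"
  shows "reduces u e"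
proof -
  have "l \<noteq> j" using kl e led_byD(5) led_by_disjoint by blast
  moreover have "lab j \<le> lab l"
    using led_by_edge_cases[OF e(1) lt[OF e(2,3)] UnI2[OF kl(1)] lt[OF e(2) kl(2)]] by blast
  ultimately have jl: "lab j < lab l" using inj by (metis injD le_neq_implies_less)
  obtain i where li: "Upair l i \<in> keys u"
    using exists_incident[OF led_byD(4), of l k] kl(1) by (auto simp: Upair_commute)
  have i: "i \<in> R" by (rule col[OF li])
  have il: "Upair i l \<in> keys u" using li by (simp add: Upair_commute)
  have "i \<noteq> k" using il kl(1) led_by_disjoint by blast
  then have ik: "lab i < lab k"
    using led_by_edge_cases[OF e(1) lt[OF e(2,3)] UnI1[OF il] lt[OF i kl(2)]] by blast
  show ?thesis
  proof (rule reducesI[OF e(1) il])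
    show "Upair i l \<noteq> e" using ik lt[OF e(2) kl(2)] unfolding e(1) by auto
    show "Upair k l \<in> E" "Upair i j \<in> E" using adj e i kl by blast+
    then show "(Upair k l, e) \<in> r" "(Upair i j, e) \<in> r"
      using edge_less_iff[of k l k j] edge_less_iff[of i j k j] led_byD(6) lt e i kl(2) jl ik by auto
  qed
qed

lemma reduces_bipartite:
  assumes cb: "complete_bipartite E UNIV V1 V2"
    and lt: "\<And>x y. x \<in> V1 \<Longrightarrow> y \<in> V2 \<Longrightarrow> lab x < lab y"
  shows "reduces u e"
proof -
  have disj: "V1 \<inter> V2 = {}" and E: "E = {Upair i j | i j. i \<in> V1 \<and> j \<in> V2}"
    using cb by (auto simp: complete_bipartite_def)
  have other1: "y \<in> V2" if "Upair x y \<in> E" "x \<in> V1" for x y using that disj unfolding E by auto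
  have other2: "y \<in> V1" if "Upair x y \<in> E" "x \<in> V2" for x y using that disj unfolding E by auto
  obtain k j where e: "e = Upair k j" "k \<in> V1" "j \<in> V2" using led_byD(6) unfolding E by blast
  obtain l where kl: "Upair k l \<in> keys v"
    using exists_incident[OF led_byD(3), of k j] led_byD(5) e(1) by blast
  have "Upair k l \<in> E" using kl led_byD(2) by blast
  then have l: "l \<in> V2" using other1 e(2) by blast
  show ?thesis
  proof (rule reduces_matrix[OF e _ lt kl l])
    show "Upair x y \<in> E" if "x \<in> V1" "y \<in> V2" for x y using that unfolding E by blast
    show "x \<in> V1" if "Upair l x \<in> keys u" for x using other2[OF _ l] that led_byD(1) by blast
  qed
qed

text \<open>
  Listing the apex \<open>z\<close> both as a row and as a column turns the graph into the complete bipartite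
  graph on \<open>{z} \<union> V1\<close> and \<open>{z} \<union> V2\<close>. The column of \<open>z\<close> has the entries \<open>x z\<close> for
  \<open>x \<in> {z} \<union> V1\<close>, whose number in a monomial is not a vertex degree but is half the total of the
  weight that is \<open>1\<close> on \<open>z\<close> and \<open>V1\<close> and \<open>- 1\<close> on \<open>V2\<close>.
\<close>

lemma reduces_cone:
  assumes beta: "type_beta E z V1 V2"
    and lz: "\<And>x. x \<noteq> z \<Longrightarrow> lab z < lab x" and lt: "\<And>x y. x \<in> V1 \<Longrightarrow> y \<in> V2 \<Longrightarrow> lab x < lab y"
  shows "reduces u e"
proof -
  have loops: "loops E = {z}" using beta by (simp add: type_beta_def)
  have cb: "complete_bipartite (induced E (- {z})) (- {z}) V1 V2"
    using beta unfolding type_beta_def loops by blast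
  have un: "V1 \<union> V2 = - {z}" using cb unfolding complete_bipartite_def by (elim conjE)
  have disj: "V1 \<inter> V2 = {}" using cb unfolding complete_bipartite_def by (elim conjE)
  have ind: "induced E (- {z}) = {Upair i j | i j. i \<in> V1 \<and> j \<in> V2}"
    using cb unfolding complete_bipartite_def by (elim conjE)
  have cone: "Upair z x \<in> E" if "x \<noteq> z" for x
    using beta that unfolding type_beta_def loops by blast
  have zz: "Upair z z \<in> E" using loops by auto
  have V: "z \<notin> V1" "z \<notin> V2" using un by auto
  have E12: "Upair x y \<in> E" if "x \<in> V1" "y \<in> V2" for x y
  proof -
    have "Upair x y \<in> induced E (- {z})" using that unfolding ind by blast
    then show ?thesis by (simp add: induced_def)
  qed
  have edge_cases: "x = z \<or> y = z \<or> x \<in> V1 \<and> y \<in> V2 \<or> x \<in> V2 \<and> y \<in> V1" if "Upair x y \<in> E" for x y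
  proof (cases "x = z \<or> y = z")
    case False
    then have "Upair x y \<in> induced E (- {z})" using that by (auto simp: induced_def)
    then show ?thesis unfolding ind by auto
  qed blast
  obtain a b where ab: "e = Upair a b" by (cases e)
  have "a = z \<or> b = z \<or> a \<in> V1 \<and> b \<in> V2 \<or> a \<in> V2 \<and> b \<in> V1" using edge_cases led_byD(6) ab by blast
  then consider "e = Upair z z" | j where "e = Upair z j" "j \<noteq> z" | k j where "e = Upair k j" "k \<in> V1" "j \<in> V2"
    using ab Upair_commute[of a b] by metis
  then show ?thesis
  proof cases
    case 1
    then show ?thesis using reduces_loop cone by blast
  next
    case (2 j)
    have "Upair j z \<in> keys u" using led_byD(5) 2 by (simp add: Upair_commute)
    then obtain x where x: "Upair j x \<in> keys v" using exists_incident[OF led_byD(3)] by blast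
    have "x \<noteq> z" using x led_byD(5) led_by_disjoint unfolding 2(1) by (auto simp: Upair_commute)
    have "j \<noteq> x" using led_by_no_loop[OF 2(1)] x 2(2) by blast
    have "\<not> lab p < lab q" if "Upair p q \<in> keys v" "p \<noteq> z" for p q
      using led_by_edge_cases[OF 2(1) lz[OF 2(2)], of p q] that lz[of p] by auto
    from this[OF x 2(2)] this[of x j] have "\<not> lab j < lab x" "\<not> lab x < lab j"
      using x \<open>x \<noteq> z\<close> unfolding Upair_commute[of x j] by blast+
    then have "lab j = lab x" by simp
    then show ?thesis using \<open>j \<noteq> x\<close> inj by (meson injD)
  next
    case (3 k j)
    note e = 3
    have ne: "k \<noteq> z" "j \<noteq> z" "k \<noteq> j" using 3 V disj by auto
    let ?R = "insert z V1"
    have ltR: "lab x < lab y" if "x \<in> ?R" "y \<in> V2" for x y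
    proof (cases "x = z")
      case True
      then show ?thesis using lz[of y] that(2) V(2) by blast
    qed (use lt that in blast)
    have adjR: "Upair x y \<in> E" if "x \<in> ?R" "y \<in> V2" for x y
    proof (cases "x = z")
      case True
      then show ?thesis using cone[of y] that(2) V(2) by blast
    qed (use E12 that in blast)
    obtain l where kl: "Upair k l \<in> keys v"
      using exists_incident[OF led_byD(3), of k j] led_byD(5) e(1) by blast
    have klE: "Upair k l \<in> E" using kl led_byD(2) by blast
    then have "l = z \<or> l \<in> V2" using edge_cases[OF klE] ne(1) e(2) disj by blast
    then show ?thesis
    proof
      assume l: "l \<in> V2"
      show ?thesis
      proof (rule reduces_matrix[OF e(1) _ e(3) adjR ltR kl l])
        show "k \<in> ?R" using e(2) by simp
        show "x \<in> ?R" if "Upair l x \<in> keys u" for x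
        proof -
          have "Upair l x \<in> E" using that led_byD(1) by blast
          then show ?thesis using edge_cases[of l x] l V disj by blast
        qed
      qed
    next
      \<comment> \<open>Now \<open>v\<close> has an entry in the column of \<open>z\<close>, and so has \<open>u\<close>. Its row precedes that of \<open>e\<close>,
         because the only entry that a later row can have is the one in the column of \<open>z\<close>, which would
         then occur in \<open>u\<close> and \<open>v\<close> alike.\<close>
      assume l: "l = z"
      let ?w = "\<lambda>x. if x \<in> V2 then - 1 else 1 :: real"
      have w: "weight ?w f \<ge> 0" if "f \<in> E" for f
      proof (cases f)
        case (Upair x y)
        then show ?thesis using edge_cases[of x y] that disj V by auto
      qed
      have "weight ?w (Upair k l) > 0" using l V e(2) disj by auto
      then obtain f where f: "f \<in> keys u" "weight ?w f > 0"
        using exists_positive_weight[OF led_byD(4) _ kl, of ?w] w led_byD(2) by blast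
      obtain x y where xy: "f = Upair x y" by (cases f)
      have fE: "Upair x y \<in> E" using f(1) xy led_byD(1) by blast
      have "x \<noteq> y" using led_by_no_loop[OF e(1) ne(3)] f(1) xy by blast
      moreover have "x \<notin> V2" "y \<notin> V2" using f(2) xy by (auto split: if_splits)
      ultimately have "x = z \<and> y \<in> V1 \<or> y = z \<and> x \<in> V1" using edge_cases[OF fE] un by blast
      then obtain i where i: "f = Upair i z" "i \<in> V1" using xy Upair_commute[of x y] by metis
      have iz: "i \<noteq> z" using i V by blast
      have "i \<noteq> k" using i(1) f(1) kl l led_by_disjoint by blast
      obtain x where x: "Upair i x \<in> keys v" using exists_incident[OF led_byD(3), of i z] f(1) i(1) by blast
      have xE: "Upair i x \<in> E" using x led_byD(2) by blast
      have "x \<noteq> z" using x f(1) i(1) led_by_disjoint by blast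
      then have xV: "x \<in> V2" using edge_cases[OF xE] iz i(2) disj by blast
      have ik: "lab i < lab k"
        using led_by_edge_cases[OF e(1) lt[OF e(2,3)] UnI2[OF x] lt[OF i(2) xV]] \<open>i \<noteq> k\<close> by blast
      show ?thesis
      proof (rule reducesI[OF e(1)])
        show "Upair i z \<in> keys u" using f(1) i(1) by simp
        show "Upair i z \<noteq> e" using e(1) ne by auto
        show kz: "Upair k z \<in> E" using klE l by simp
        show ij: "Upair i j \<in> E" using E12 i(2) e(3) by blast
        have eE: "Upair k j \<in> E" using led_byD(6) e(1) by simp
        have "Upair z k \<in> E" using cone ne(1) by blast
        then have "(Upair z k, e) \<in> r"
          using edge_less_iff[OF _ eE lz[OF ne(1)] lt[OF e(2,3)]] lz[OF ne(1)] unfolding e(1) by blast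
        then show "(Upair k z, e) \<in> r" unfolding Upair_commute[of k z] .
        show "(Upair i j, e) \<in> r"
          using edge_less_iff[OF ij eE lt[OF i(2) e(3)] lt[OF e(2,3)]] ik unfolding e(1) by blast
      qed
    qed
  qed
qed

text \<open>
  Here \<open>A\<close> is the set of vertices that occur at all: every vertex when the looped clique \<open>L\<close> is joined
  to an independent set, and only \<open>L\<close> itself when the vertices of the polytope are linearly independent.
  
  Let \<open>e\<close> be the edge \<open>i j\<close> with \<open>i\<close> before \<open>j\<close>. If \<open>v\<close> has an edge from \<open>i\<close> to a later vertex,
  the exchange is the one of a matrix. Otherwise every edge of \<open>v\<close> has an end before \<open>i\<close>, while \<open>e\<close>
  has none; by balance some edge of \<open>u\<close> has both ends before \<open>i\<close>, and any exchange with it will do.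
\<close>

lemma reduces_looped_clique:
  assumes L: "L \<subseteq> A" and low: "\<And>x y. x \<in> L \<Longrightarrow> y \<notin> L \<Longrightarrow> lab x < lab y"
    and adj: "\<And>x y. x \<in> L \<Longrightarrow> y \<in> A \<Longrightarrow> Upair x y \<in> E"
    and sup: "\<And>x y. Upair x y \<in> keys u \<union> keys v \<Longrightarrow> x \<in> A \<and> y \<in> A \<and> (x \<in> L \<or> y \<in> L)"
  shows "reduces u e"
proof -
  have down: "x \<in> L" if "lab x < lab y" "y \<in> L" for x y
    using low[OF that(2), of x] that(1) by fastforce
  obtain a b where ab: "e = Upair a b" by (cases e)
  consider "a = b" | "lab a < lab b" | "lab b < lab a" using inj by (metis injD nat_neq_iff)
  then consider i where "e = Upair i i" | i j where "e = Upair i j" "lab i < lab j"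
    using ab Upair_commute[of a b] by metis
  then show ?thesis
  proof cases
    case (1 i)
    have "i \<in> L" using sup[of i i] led_byD(5) 1 by auto
    show ?thesis
    proof (rule reduces_loop[OF 1])
      fix j k assume "Upair j k \<in> keys u"
      then have "j \<in> A" using sup by blast
      then show "Upair i j \<in> E" using adj \<open>i \<in> L\<close> by blast
    qed
  next
    case (2 i j)
    note e = 2(1) and ij = 2(2)
    have ne: "i \<noteq> j" using ij by auto
    have eu: "Upair i j \<in> keys u" and eE: "Upair i j \<in> E" using led_byD(5,6) e by auto
    have jA: "j \<in> A" and "i \<in> L \<or> j \<in> L" using sup[of i j] eu by blast+
    then have iL: "i \<in> L" using down[OF ij] by blast
    have ordered: "lab x < lab y \<or> lab y < lab x" if "Upair x y \<in> keys u \<union> keys v" for x y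
    proof -
      have "x \<noteq> y" using led_by_no_loop[OF e ne] that by blast
      then show ?thesis using inj by (metis injD nat_neq_iff)
    qed
    note cases = led_by_edge_cases[OF e ij]
    show ?thesis
    proof (cases "\<exists>l. Upair i l \<in> keys v \<and> lab i < lab l")
      case True
      then obtain l where l: "Upair i l \<in> keys v" "lab i < lab l" by blast
      have "l \<noteq> j" using l(1) eu led_by_disjoint by blast
      then have jl: "lab j < lab l" using cases[OF UnI2[OF l(1)] l(2)] inj_eq[OF inj, of j l] by auto
      have lA: "l \<in> A" using sup[of i l] l(1) by blast
      obtain x where x: "Upair l x \<in> keys u"
        using exists_incident[OF led_byD(4), of l i] l(1) by (auto simp: Upair_commute)
      have xl: "Upair x l \<in> keys u" using x by (simp add: Upair_commute)
      have "\<not> lab l < lab x" using cases[OF UnI1[OF x]] l(2) by auto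
      then have lxl: "lab x < lab l" using ordered[OF UnI1[OF x]] by blast
      have "x \<noteq> i" using xl l(1) led_by_disjoint by blast
      then have xi: "lab x < lab i" using cases[OF UnI1[OF xl] lxl] by blast
      show ?thesis
      proof (rule reducesI[OF e xl])
        show "Upair x l \<noteq> e" using xi ij unfolding e by auto
        show il: "Upair i l \<in> E" using adj iL lA by blast
        show xj: "Upair x j \<in> E" using adj down[OF xi iL] jA by blast
        show "(Upair i l, e) \<in> r" using edge_less_iff[OF il eE l(2) ij] jl unfolding e by blast
        show "(Upair x j, e) \<in> r" using edge_less_iff[OF xj eE _ ij] xi ij unfolding e by simp
      qed
    next
      case False
      \<comment> \<open>The weight of an edge is positive iff both ends come from \<open>i\<close> onwards, and negative iff both
         come before \<open>i\<close>.\<close>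
      let ?w = "\<lambda>x. if lab x < lab i then - 1 else 1 :: real"
      have v: "weight ?w f \<le> 0" if f: "f \<in> keys v" for f
      proof -
        have below: "lab x < lab i" if xy: "Upair x y \<in> keys v" "lab x < lab y" for x y
          using cases[OF UnI2[OF xy(1)] xy(2)] False xy by blast
        obtain x y where xy: "f = Upair x y" by (cases f)
        have "Upair x y \<in> keys v" "Upair y x \<in> keys v" using f xy by (auto simp: Upair_commute)
        then have "lab x < lab i \<or> lab y < lab i" using below ordered by blast
        then show ?thesis by (auto simp: xy)
      qed
      have "\<exists>f\<in>keys u. weight ?w f < 0"
      proof (rule ccontr)
        assume "\<not> (\<exists>f\<in>keys u. weight ?w f < 0)"
        then have "\<exists>f\<in>keys v. weight ?w f > 0"
          by (intro exists_positive_weight[OF led_byD(3) _ eu]) (use ij in \<open>auto simp: not_less\<close>)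
        then show False using v by (meson not_less)
      qed
      then obtain f where f: "f \<in> keys u" "weight ?w f < 0" by blast
      obtain k l where kl: "f = Upair k l" by (cases f)
      have ki: "lab k < lab i" and li: "lab l < lab i"
        using f(2) unfolding kl by (auto split: if_splits)
      show ?thesis
      proof (rule reducesI[OF e])
        show "Upair k l \<in> keys u" using f(1) kl by simp
        show "Upair k l \<noteq> e" using ki ij li unfolding e by auto
        show il: "Upair i l \<in> E" using adj iL down[OF li iL] L by blast
        have li': "Upair l i \<in> E" using il by (simp add: Upair_commute)
        show kj: "Upair k j \<in> E" using adj down[OF ki iL] jA by blast
        show "(Upair i l, e) \<in> r"
          using edge_less_iff[OF li' eE li ij] li unfolding e Upair_commute[of i l] by blast
        show "(Upair k j, e) \<in> r" using edge_less_iff[OF kj eE _ ij] ki ij unfolding e by simp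
      qed
    qed
  qed
qed

text \<open>
  A variable on which two monomials of a fibre differ has its vector in the span of the others, and
  the vectors of edges between looped vertices are in turn combinations of those of loops.
\<close>

lemma led_by_support_looped:
  assumes ind: "independent (edge_point ` vertex_edges E)" and xy: "Upair x y \<in> keys u \<union> keys v"
  shows "x \<in> loops E \<and> y \<in> loops E"
proof (rule ccontr)
  assume n: "\<not> ?thesis"
  let ?g = "Upair x y"
  have gE: "?g \<in> E" using xy led_byD by blast
  have gV: "?g \<in> vertex_edges E" using gE n by (cases "x = y") (auto simp: vertex_edges_Upair_iff)
  have "lookup u ?g \<noteq> lookup v ?g"
    using xy led_by_disjoint[of ?g] by (auto simp: in_keys_iff)
  then have "edge_point ?g \<in> span (edge_point ` (E - {?g}))"
    by (rule relation_in_span[OF led_byD(3,1,2)])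
  also have "\<dots> \<subseteq> span (edge_point ` (vertex_edges E - {?g}))"
  proof (rule span_minimal)
    show "edge_point ` (E - {?g}) \<subseteq> span (edge_point ` (vertex_edges E - {?g}))"
    proof (rule image_subsetI)
      fix f assume f: "f \<in> E - {?g}"
      show "edge_point f \<in> span (edge_point ` (vertex_edges E - {?g}))"
      proof (cases "f \<in> vertex_edges E")
        case True
        then show ?thesis using f by (intro span_base) blast
      next
        case False
        then obtain i j where fij: "f = Upair i j" "Upair i i \<in> E" "Upair j j \<in> E"
          using f by (auto simp: vertex_edges_def)
        have "Upair i i \<noteq> ?g" "Upair j j \<noteq> ?g" using n fij by auto
        then have "edge_point (Upair i i) \<in> span (edge_point ` (vertex_edges E - {?g}))"
          "edge_point (Upair j j) \<in> span (edge_point ` (vertex_edges E - {?g}))"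
          using vertex_edges_loop[OF fij(2)] vertex_edges_loop[OF fij(3)] by (blast intro: span_base)+
        then show ?thesis by (rule span_combination(2)) (simp add: fij(1) vec_eq_iff)
      qed
    qed
  qed simp
  finally show False
    using independent_no_relation[OF ind gV, of "vertex_edges E - {?g}"] by blast
qed

end

end

section \<open>The reduced Groebner basis\<close>

theorem theorem2p1:
  fixes E :: "'v::finite uprod set"
    and lab :: "'v \<Rightarrow> nat"
    and r :: "'v uprod rel"
  assumes "no_isolated_vertex E"
    and "loops_adjacent E"
    and "simple_polytope (edge_polytope E)"
    and "(toric_ideal E :: ('v uprod, 'k::field) mpoly set) \<noteq> {0}"
    and "labelling E lab"
    and "admissible_var_order E lab r"
  shows "(\<exists>!B :: ('v uprod, 'k) mpoly set.
            reduced_groebner_basis (poly_ring E) (lex_less E r) (toric_ideal E) B) \<and>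
         (\<forall>B :: ('v uprod, 'k) mpoly set.
            reduced_groebner_basis (poly_ring E) (lex_less E r) (toric_ideal E) B \<longrightarrow>
            (\<forall>g\<in>B. quadratic_binomial g \<and> squarefree_monomial (initial_monomial (lex_less E r) g)))"
proof -
  interpret simple_edge_polytope E by unfold_locales fact+
  have bij: "bij_betw lab UNIV {1..CARD('v)}" using assms(5) by (simp add: labelling_def)
  then have inj: "inj lab" and range: "range lab = {1..CARD('v)}" by (simp_all add: bij_betw_def)
  have pos: "1 \<le> lab x" for x using range by (metis atLeastAtMost_iff rangeI)
  have "strict_linear_order_on E r" using assms(6) by (simp add: admissible_var_order_def)
  then interpret ordered_edges E r lab
    using assms(6) inj by unfold_locales simp_all
  note lbl = assms(5)[unfolded labelling_def, THEN conjunct2]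
  note alpha_labels = lbl[THEN conjunct1] and beta_labels = lbl[THEN conjunct2, THEN conjunct1]
    and gamma_labels = lbl[THEN conjunct2, THEN conjunct2, THEN conjunct1]
    and simplex_labels = lbl[THEN conjunct2, THEN conjunct2, THEN conjunct2]
  have low: "lab x < lab y" if "lab ` S = {a..m}" "x \<in> S" "y \<notin> S" "a \<le> lab y" for S a m x y
  proof -
    have "lab x \<in> {a..m}" using that(1,2) by blast
    moreover have "lab y \<notin> {a..m}" using that(1,3) inj_image_mem_iff[OF inj, of y S] by simp
    ultimately show ?thesis using that(4) by auto
  qed
  have red: "reduces u e" if lead: "led_by u v e" for u v e
  proof -
    consider "\<exists>V1 V2. type_alpha E V1 V2" | "\<exists>z V1 V2. type_beta E z V1 V2" | "type_gamma E"
      | "type_simplex E" "independent (edge_point ` vertex_edges E)"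
      using classification[OF toric_ideal_nonzero_dependent[OF assms(4)]] by blast
    then show ?thesis
    proof cases
      case 1
      with alpha_labels obtain V1 V2 m where V: "type_alpha E V1 V2" "lab ` V1 = {1..m}"
        by blast
      then have cb: "complete_bipartite E UNIV V1 V2" by (simp add: type_alpha_def)
      then have disj: "V1 \<inter> V2 = {}" by (simp add: complete_bipartite_def)
      show ?thesis
      proof (rule reduces_bipartite[OF lead cb])
        show "lab x < lab y" if "x \<in> V1" "y \<in> V2" for x y
          using low[OF V(2) that(1) _ pos] that(2) disj by blast
      qed
    next
      case 2
      with beta_labels obtain z V1 V2 m where V: "type_beta E z V1 V2" "lab z = 1" "lab ` V1 = {2..m}"
        "lab ` V2 = {m+1..CARD('v)}" by blast
      have "lab z < lab x" if "x \<noteq> z" for x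
        using pos[of x] V(2) inj_eq[OF inj, of x z] that by simp
      moreover have "lab x < lab y" if "x \<in> V1" "y \<in> V2" for x y
      proof -
        have "lab x \<in> {2..m}" "lab y \<in> {m+1..CARD('v)}" using V that by blast+
        then show ?thesis by auto
      qed
      ultimately show ?thesis using reduces_cone[OF lead V(1)] by blast
    next
      case 3
      with gamma_labels obtain m where m: "lab ` loops E = {1..m}" by blast
      have indep: "induced E (- loops E) = {}" using 3 by (simp add: type_gamma_def)
      have join: "Upair x y \<in> E" if "x \<in> loops E" "y \<in> - loops E" for x y
        using 3 that unfolding type_gamma_def by blast
      show ?thesis
      proof (rule reduces_looped_clique[OF lead, of "loops E" UNIV])
        show "lab x < lab y" if "x \<in> loops E" "y \<notin> loops E" for x y by (rule low[OF m that pos])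
        show "Upair x y \<in> E" if "x \<in> loops E" for x y
          using join[OF that, of y] loops_adj[of x y] that by (cases "y \<in> loops E") auto
        show "x \<in> UNIV \<and> y \<in> UNIV \<and> (x \<in> loops E \<or> y \<in> loops E)" if "Upair x y \<in> keys u \<union> keys v" for x y
        proof -
          have "Upair x y \<in> E" using that led_byD(1,2)[OF lead] by blast
          then show ?thesis using indep by (auto simp: induced_def)
        qed
      qed simp
    next
      case 4
      with simplex_labels obtain m where m: "lab ` loops E = {1..m}" by blast
      show ?thesis
      proof (rule reduces_looped_clique[OF lead, of "loops E" "loops E"])
        show "lab x < lab y" if "x \<in> loops E" "y \<notin> loops E" for x y by (rule low[OF m that pos])
        show "Upair x y \<in> E" if "x \<in> loops E" "y \<in> loops E" for x y
          using loops_adj that by auto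
        show "x \<in> loops E \<and> y \<in> loops E \<and> (x \<in> loops E \<or> y \<in> loops E)" if "Upair x y \<in> keys u \<union> keys v" for x y
          using led_by_support_looped[OF lead 4(2) that] by blast
      qed simp
    qed
  qed
  interpret quadratically_reducible E r edge_degree
  proof
    fix u v :: "'v uprod monomial"
    assume "image_monomial edge_degree u = image_monomial edge_degree v"
    then show "monomial_degree u = monomial_degree v" by (rule image_monomial_edge_degree_homogeneous)
  next
    fix u v :: "'v uprod monomial" and e
    assume "keys u \<subseteq> E" "keys v \<subseteq> E" "image_monomial edge_degree u = image_monomial edge_degree v"
      "keys u \<inter> keys v = {}" "e \<in> keys u" "\<And>g. g \<in> keys u \<union> keys v \<Longrightarrow> g \<noteq> e \<Longrightarrow> (g, e) \<in> r"
    then have "led_by u v e" unfolding led_by_def by simp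
    from red[OF this] show "\<exists>f e' f'. f \<in> keys u \<and> f \<noteq> e \<and> e' \<in> E \<and> f' \<in> E \<and> (e', e) \<in> r \<and> (f', e) \<in> r \<and>
        edge_degree e + edge_degree f = edge_degree e' + edge_degree f'"
      unfolding reduces_def .
  qed
  have "(toric_ideal E :: ('v uprod, 'k) mpoly set) = kernel"
    by (simp add: toric_ideal_def kernel_def edge_monomial_eq)
  then show ?thesis using reduced_groebner_basis_quadratic_squarefree by simp
qed

end
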